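(* Let $\Sigma$ be a complete simplicial (not necessarily rational) fan in $\mathbb R^n$ with $m$ one-dimensional cones, with chosen generators $\boldsymbol a_1,\ldots,\boldsymbol a_m$, and let $\mathcal K=\mathcal K_\Sigma$ be its underlying simplicial complex on $[m]$. Then: (a) the group $R_\Sigma$ acts on $U(\mathcal K)$ freely and properly, and the quotient $U(\mathcal K)/R_\Sigma$ is a smooth $(m+n)$-dimensional manifold; (b) $U(\mathcal K)/R_\Sigma$ is $\mathbb T^m$-equivariantly homeomorphic to the moment-angle complex $\mathcal Z_{\mathcal K}$. Therefore $\mathcal Z_{\mathcal K}$ can be smoothed (admits a smooth structure).
   Context: A fan in $\mathbb R^n$ is a finite collection of strongly convex polyhedral cones (containing no line) such that every face of a cone of the collection is in the collection and the intersection of any two of its cones is a face of each. It is complete if the union of its cones is $\mathbb R^n$, and simplicial if every cone is generated by part of a basis of $\mathbb R^n$. The underlying simplicial complex $\mathcal K_\Sigma$ on $[m]=\{1,\ldots,m\}$ consists of all $I\subset[m]$ (including $\varnothing$) such that $\{\boldsymbol a_i: i\in I\}$ spans a cone of $\Sigma$. For a simplicial complex $\mathcal K$ on $[m]$ and a pair of spaces $W\subset X$, put $(X,W)^{\mathcal K}=\bigcup_{I\in\mathcal K}\{(x_1,\ldots,x_m)\in X^m: x_j\in W\text{ for }j\notin I\}$. With $\mathbb D\subset\mathbb C$ the closed unit disc, $\mathbb T$ the unit circle and $\mathbb C^\times=\mathbb C\setminus\{0\}$, the moment-angle complex is $\mathcal Z_{\mathcal K}=(\mathbb D,\mathbb T)^{\mathcal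 K}\subset\mathbb C^m$, and $U(\mathcal K)=(\mathbb C,\mathbb C^\times)^{\mathcal K}=\mathbb C^m\setminus\bigcup_{\{i_1,\ldots,i_k\}\notin\mathcal K}\{z_{i_1}=\cdots=z_{i_k}=0\}$. The torus $\mathbb T^m$ acts on both coordinatewise. Let $\Lambda_{\mathbb R}\colon\mathbb R^m\to\mathbb R^n$ be the linear map with $\boldsymbol e_i\mapsto\boldsymbol a_i$, and let $\mathbb R^m_>$ be the multiplicative group of $m$-tuples of positive reals. Define $R_\Sigma=\exp(\operatorname{Ker}\Lambda_{\mathbb R})=\{(y_1,\ldots,y_m)\in\mathbb R^m_>:\prod_{i=1}^m y_i^{\langle\boldsymbol a_i,\boldsymbol u\rangle}=1\text{ for all }\boldsymbol u\in\mathbb R^n\}$ (componentwise exponential). It acts on $U(\mathcal K)$ by coordinatewise multiplication. An action of a topological group $G$ on $X$ is proper if the map $G\times X\to X\times X$, $(g,x)\mapsto(gx,x)$, is proper. *)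

theory Defs
  imports "HOL-Analysis.Analysis" "HOL-Algebra.Group_Action"
begin

section \<open>Fans\<close>

definition polyhedral_cone :: "'a::euclidean_space set \<Rightarrow> bool" where
  "polyhedral_cone \<sigma> \<longleftrightarrow> (\<exists>S. finite S \<and> \<sigma> = convex_cone hull S)"

definition strongly_convex :: "'a::euclidean_space set \<Rightarrow> bool" where
  "strongly_convex \<sigma> \<longleftrightarrow> \<not> (\<exists>x v. v \<noteq> 0 \<and> range (\<lambda>t::real. x + t *\<^sub>R v) \<subseteq> \<sigma>)"

text \<open>The library relation \<^const>\<open>face_of\<close> also counts the empty set as a face; faces of cones are
  the nonempty ones. The intersection of two cones contains the origin, so it needs no
  such proviso.\<close>

definition fan :: "'a::euclidean_space set set \<Rightarrow> bool" where
  "fan \<Sigma> \<longleftrightarrow>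
     finite \<Sigma> \<and>
     (\<forall>\<sigma>\<in>\<Sigma>. polyhedral_cone \<sigma> \<and> strongly_convex \<sigma>) \<and>
     (\<forall>\<sigma>\<in>\<Sigma>. \<forall>\<tau>. \<tau> face_of \<sigma> \<and> \<tau> \<noteq> {} \<longrightarrow> \<tau> \<in> \<Sigma>) \<and>
     (\<forall>\<sigma>\<in>\<Sigma>. \<forall>\<tau>\<in>\<Sigma>. (\<sigma> \<inter> \<tau>) face_of \<sigma> \<and> (\<sigma> \<inter> \<tau>) face_of \<tau>)"

definition complete_fan :: "'a::euclidean_space set set \<Rightarrow> bool" where
  "complete_fan \<Sigma> \<longleftrightarrow> fan \<Sigma> \<and> \<Union>\<Sigma> = UNIV"

definition simplicial_fan :: "'a::euclidean_space set set \<Rightarrow> bool" where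
  "simplicial_fan \<Sigma> \<longleftrightarrow>
     fan \<Sigma> \<and>
     (\<forall>\<sigma>\<in>\<Sigma>. \<exists>B S. independent B \<and> span B = UNIV \<and> S \<subseteq> B \<and> \<sigma> = convex_cone hull S)"

text \<open>A choice of one generator for each one-dimensional cone, the rays being indexed bijectively
  by the finite type \<open>'m\<close>, which plays the role of \<open>{1..m}\<close>.\<close>

definition ray_generators :: "'a::euclidean_space set set \<Rightarrow> ('m::finite \<Rightarrow> 'a) \<Rightarrow> bool" where
  "ray_generators \<Sigma> a \<longleftrightarrow>
     bij_betw (\<lambda>i. convex_cone hull {a i}) UNIV {\<rho> \<in> \<Sigma>. dim \<rho> = 1}"

definition underlying_complex ::
    "'a::euclidean_space set set \<Rightarrow> ('m::finite \<Rightarrow> 'a) \<Rightarrow> 'm set set" where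
  "underlying_complex \<Sigma> a = {I. convex_cone hull (a ` I) \<in> \<Sigma>}"


section \<open>Polyhedral products\<close>

definition polyhedral_product :: "'x set \<Rightarrow> 'x set \<Rightarrow> 'm::finite set set \<Rightarrow> ('x ^ 'm) set" where
  "polyhedral_product X W K =
     (\<Union>I\<in>K. {x. (\<forall>j. x $ j \<in> X) \<and> (\<forall>j. j \<notin> I \<longrightarrow> x $ j \<in> W)})"

definition moment_angle_complex :: "'m::finite set set \<Rightarrow> (complex ^ 'm) set" where
  "moment_angle_complex K = polyhedral_product (cball 0 1) (sphere 0 1) K"

definition U_space :: "'m::finite set set \<Rightarrow> (complex ^ 'm) set" where
  "U_space K = polyhedral_product UNIV (- {0}) K"

lemma U_space_eq_complement:
  fixes K :: "'m::finite set set"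
  assumes "\<And>I J. I \<in> K \<Longrightarrow> J \<subseteq> I \<Longrightarrow> J \<in> K"
  shows "U_space K = UNIV - (\<Union>I\<in>-K. {z. \<forall>i\<in>I. z $ i = 0})"
proof (intro subset_antisym subsetI)
  fix z assume "z \<in> U_space K"
  then obtain I where I: "I \<in> K" "\<And>j. j \<notin> I \<Longrightarrow> z $ j \<noteq> 0"
    by (auto simp: U_space_def polyhedral_product_def)
  have "J \<in> K" if "\<forall>i\<in>J. z $ i = 0" for J
    using assms[OF I(1), of J] I(2) that by blast
  then show "z \<in> UNIV - (\<Union>I\<in>-K. {z. \<forall>i\<in>I. z $ i = 0})" by auto
next
  fix z :: "complex ^ 'm"
  assume z: "z \<in> UNIV - (\<Union>I\<in>-K. {z. \<forall>i\<in>I. z $ i = 0})"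
  then have "{i. z $ i = 0} \<in> K" by auto
  then show "z \<in> U_space K"
    by (auto simp: U_space_def polyhedral_product_def intro!: bexI[of _ "{i. z $ i = 0}"])
qed

text \<open>The multiplication of \<^typ>\<open>complex ^ 'm\<close> is componentwise, so \<open>(*)\<close> gives both the group law
  of the torus and its coordinatewise action.\<close>

definition torus :: "(complex ^ 'm::finite) set" where
  "torus = {t. \<forall>i. t $ i \<in> sphere 0 1}"


section \<open>The group \<open>R\<^sub>\<Sigma>\<close> and its action\<close>

definition Lambda_R :: "('m::finite \<Rightarrow> 'a::real_vector) \<Rightarrow> real ^ 'm \<Rightarrow> 'a" where
  "Lambda_R a x = (\<Sum>i\<in>UNIV. x $ i *\<^sub>R a i)"

definition R_group :: "('m::finite \<Rightarrow> 'a::real_vector) \<Rightarrow> (real ^ 'm) monoid" where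
  "R_group a =
     \<lparr>carrier = (\<lambda>x. \<chi> i. exp (x $ i)) ` {x. Lambda_R a x = 0}, mult = (*), one = 1\<rparr>"

lemma carrier_R_group_eq:
  fixes a :: "'m::finite \<Rightarrow> 'a::euclidean_space"
  shows "carrier (R_group a) =
    {y. (\<forall>i. y $ i > 0) \<and> (\<forall>u. (\<Prod>i\<in>UNIV. y $ i powr (a i \<bullet> u)) = 1)}"
    (is "_ = ?R")
proof -
  have exp_prod: "(\<Prod>i\<in>UNIV. exp (x $ i) powr (a i \<bullet> u)) = exp (Lambda_R a x \<bullet> u)"
    for x :: "real ^ 'm" and u
    by (simp add: Lambda_R_def inner_sum_left exp_sum powr_def mult.commute)
  show ?thesis
  proof (intro subset_antisym subsetI)
    fix y assume "y \<in> carrier (R_group a)"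
    then obtain x where x: "Lambda_R a x = 0" and y: "y = (\<chi> i. exp (x $ i))"
      unfolding R_group_def by auto
    have "(\<Prod>i\<in>UNIV. y $ i powr (a i \<bullet> u)) = 1" for u
      using exp_prod[of x u] x y by simp
    then show "y \<in> ?R"
      using y by simp
  next
    fix y assume y: "y \<in> ?R"
    define x where "x = (\<chi> i. ln (y $ i))"
    have yx: "y = (\<chi> i. exp (x $ i))"
      using y by (simp add: x_def vec_eq_iff)
    have "exp (Lambda_R a x \<bullet> Lambda_R a x) = (\<Prod>i\<in>UNIV. y $ i powr (a i \<bullet> Lambda_R a x))"
      unfolding exp_prod[symmetric] yx by simp
    also have "\<dots> = 1"
      using y by blast
    finally have "Lambda_R a x = 0"
      by simp
    then show "y \<in> carrier (R_group a)"
      unfolding R_group_def using yx by auto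
  qed
qed

text \<open>The restriction to \<^term>\<open>U_space K\<close> is required by \<^locale>\<open>group_action\<close>, whose group elements
  act by extensional bijections.\<close>

definition R_action :: "'m::finite set set \<Rightarrow> real ^ 'm \<Rightarrow> complex ^ 'm \<Rightarrow> complex ^ 'm" where
  "R_action K y = (\<lambda>z\<in>U_space K. \<chi> i. of_real (y $ i) * z $ i)"

definition free_action :: "('g, 'c) monoid_scheme \<Rightarrow> 'x set \<Rightarrow> ('g \<Rightarrow> 'x \<Rightarrow> 'x) \<Rightarrow> bool" where
  "free_action G X \<phi> \<longleftrightarrow> group_action G X \<phi> \<and> (\<forall>x\<in>X. stabilizer G \<phi> x = {\<one>\<^bsub>G\<^esub>})"

text \<open>Here \<open>T\<close> is the topology of the group. Continuity is listed separately because
  \<^const>\<open>proper_map\<close> only asks for a closed map with compact fibres.\<close>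

definition proper_action ::
    "'g topology \<Rightarrow> ('g, 'c) monoid_scheme \<Rightarrow> 'x topology \<Rightarrow> ('g \<Rightarrow> 'x \<Rightarrow> 'x) \<Rightarrow> bool" where
  "proper_action T G X \<phi> \<longleftrightarrow>
     topspace T = carrier G \<and> group_action G (topspace X) \<phi> \<and>
     continuous_map (prod_topology T X) (prod_topology X X) (\<lambda>(g, x). (\<phi> g x, x)) \<and>
     proper_map (prod_topology T X) (prod_topology X X) (\<lambda>(g, x). (\<phi> g x, x))"


section \<open>Orbit spaces\<close>

definition quotient_topology :: "'x topology \<Rightarrow> ('x \<Rightarrow> 'y) \<Rightarrow> 'y topology" where
  "quotient_topology X p =
     topology (\<lambda>V. V \<subseteq> p ` topspace X \<and> openin X {x \<in> topspace X. p x \<in> V})"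

lemma openin_quotient_topology:
  "openin (quotient_topology X p) V \<longleftrightarrow>
     V \<subseteq> p ` topspace X \<and> openin X {x \<in> topspace X. p x \<in> V}"
proof -
  have "istopology (\<lambda>V. V \<subseteq> p ` topspace X \<and> openin X {x \<in> topspace X. p x \<in> V})"
    unfolding istopology_def
  proof (intro conjI allI impI)
    fix S T
    assume "S \<subseteq> p ` topspace X \<and> openin X {x \<in> topspace X. p x \<in> S}"
      and "T \<subseteq> p ` topspace X \<and> openin X {x \<in> topspace X. p x \<in> T}"
    then have "openin X ({x \<in> topspace X. p x \<in> S} \<inter> {x \<in> topspace X. p x \<in> T})"
      by blast
    moreover have "{x \<in> topspace X. p x \<in> S} \<inter> {x \<in> topspace X. p x \<in> T}
        = {x \<in> topspace X. p x \<in> S \<inter> T}" by auto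
    ultimately show "openin X {x \<in> topspace X. p x \<in> S \<inter> T}" by simp
  next
    fix \<K>
    assume "\<forall>V\<in>\<K>. V \<subseteq> p ` topspace X \<and> openin X {x \<in> topspace X. p x \<in> V}"
    then have "openin X (\<Union>V\<in>\<K>. {x \<in> topspace X. p x \<in> V})"
      by blast
    moreover have "(\<Union>V\<in>\<K>. {x \<in> topspace X. p x \<in> V}) = {x \<in> topspace X. p x \<in> \<Union>\<K>}"
      by auto
    ultimately show "openin X {x \<in> topspace X. p x \<in> \<Union>\<K>}" by simp
  qed auto
  then show ?thesis
    by (simp add: quotient_topology_def topology_inverse')
qed

lemma topspace_quotient_topology: "topspace (quotient_topology X p) = p ` topspace X"
proof -
  have "{x \<in> topspace X. p x \<in> p ` topspace X} = topspace X" by auto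
  then have "openin (quotient_topology X p) (p ` topspace X)"
    by (simp add: openin_quotient_topology)
  then show ?thesis
    by (meson openin_quotient_topology openin_subset openin_topspace subset_antisym)
qed

lemma quotient_map_quotient_topology: "quotient_map X (quotient_topology X p) p"
  by (auto simp: quotient_map_def topspace_quotient_topology openin_quotient_topology)

definition orbit_space ::
    "'x topology \<Rightarrow> ('g, 'c) monoid_scheme \<Rightarrow> ('g \<Rightarrow> 'x \<Rightarrow> 'x) \<Rightarrow> 'x set topology" where
  "orbit_space X G \<phi> = quotient_topology X (orbit G \<phi>)"

lemma topspace_orbit_space: "topspace (orbit_space X G \<phi>) = orbits G (topspace X) \<phi>"
  by (auto simp: orbit_space_def topspace_quotient_topology orbits_def)


section \<open>Smooth manifolds\<close>

text \<open>\<open>C_k_on k f S\<close> is the usual notion of a \<open>C\<^sup>k\<close> map for open \<open>S\<close> in a Euclidean space: iterated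
  directional derivatives exist up to order \<open>k\<close> and are continuous.\<close>

primrec C_k_on ::
    "nat \<Rightarrow> ('a::euclidean_space \<Rightarrow> 'b::euclidean_space) \<Rightarrow> 'a set \<Rightarrow> bool" where
  "C_k_on 0 f S \<longleftrightarrow> continuous_on S f"
| "C_k_on (Suc k) f S \<longleftrightarrow>
     (\<forall>x\<in>S. f differentiable (at x)) \<and>
     (\<forall>v. C_k_on k (\<lambda>x. frechet_derivative f (at x) v) S)"

definition smooth_on :: "('a::euclidean_space \<Rightarrow> 'b::euclidean_space) \<Rightarrow> 'a set \<Rightarrow> bool" where
  "smooth_on f S \<longleftrightarrow> (\<forall>k. C_k_on k f S)"

definition chart :: "'x topology \<Rightarrow> 'x set \<Rightarrow> ('x \<Rightarrow> 'e::euclidean_space) \<Rightarrow> bool" where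
  "chart X V \<phi> \<longleftrightarrow>
     openin X V \<and> open (\<phi> ` V) \<and>
     homeomorphic_map (subtopology X V) (top_of_set (\<phi> ` V)) \<phi>"

definition smooth_atlas ::
    "'x topology \<Rightarrow> ('x set \<times> ('x \<Rightarrow> 'e::euclidean_space)) set \<Rightarrow> bool" where
  "smooth_atlas X A \<longleftrightarrow>
     (\<forall>(V, \<phi>)\<in>A. chart X V \<phi>) \<and>
     (\<Union>(V, \<phi>)\<in>A. V) = topspace X \<and>
     (\<forall>(V, \<phi>)\<in>A. \<forall>(W, \<psi>)\<in>A. smooth_on (\<psi> \<circ> inv_into V \<phi>) (\<phi> ` (V \<inter> W)))"

text \<open>The dimension of the manifold is the dimension of the type \<open>'e\<close> in which the charts take
  values.\<close>

definition smooth_manifold ::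
    "'x topology \<Rightarrow> ('x set \<times> ('x \<Rightarrow> 'e::euclidean_space)) set \<Rightarrow> bool" where
  "smooth_manifold X A \<longleftrightarrow> Hausdorff_space X \<and> second_countable X \<and> smooth_atlas X A"

text \<open>Smooth submersions from an open subset of a Euclidean space onto a manifold.\<close>

definition smooth_submersion ::
    "'y::euclidean_space set \<Rightarrow> 'x topology \<Rightarrow> ('x set \<times> ('x \<Rightarrow> 'e::euclidean_space)) set
      \<Rightarrow> ('y \<Rightarrow> 'x) \<Rightarrow> bool" where
  "smooth_submersion S X A p \<longleftrightarrow>
     open S \<and> continuous_map (top_of_set S) X p \<and> p ` S = topspace X \<and>
     (\<forall>(V, \<phi>)\<in>A. smooth_on (\<phi> \<circ> p) (S \<inter> p -` V) \<and>
        (\<forall>x \<in> S \<inter> p -` V. surj (frechet_derivative (\<phi> \<circ> p) (at x))))"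

end

theory Submission
  imports Defs
begin

text \<open>
  Everything rests on one property of a complete simplicial fan: each point of \<open>\<real>\<^sup>n\<close> is
  \<open>\<Lambda>(y)\<close> for exactly one \<open>y \<ge> 0\<close> whose support belongs to \<open>K\<close>. Uniqueness is used in the form
  \<open>kernel_support_unique\<close>: a vector \<open>u\<close> in the kernel of \<open>\<Lambda>\<close> whose positive and negative supports
  both belong to \<open>K\<close> is zero. The locale \<open>fan_coordinates\<close> records existence and uniqueness; from
  there on no cone geometry is needed, except to see that every cone lies in one of full dimension.

  Freeness is immediate: a stabilizing \<open>exp u\<close> has \<open>u\<close> supported on the zero coordinates of the
  point, a set in \<open>K\<close>. For properness (\<open>kernel_sequence_bounded\<close>), suppose \<open>z\<^sub>k\<close> and
  \<open>exp(u\<^sub>k) z\<^sub>k\<close> converge in \<open>U(K)\<close> with \<open>u\<^sub>k\<close> unbounded. A limit of the normalized \<open>u\<^sub>k\<close> is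
  positive only where the limit of \<open>z\<^sub>k\<close> vanishes and negative only where the limit of
  \<open>exp(u\<^sub>k) z\<^sub>k\<close> vanishes, so uniqueness makes it zero, although it has norm one.

  Properness makes the orbit space Hausdorff. Inclusion followed by projection is therefore a closed
  map from the compact \<open>Z\<^sub>K\<close> to the orbit space. It is injective by uniqueness again. It
  is surjective because its image is closed and contains the orbits of all points without zero
  coordinates, a dense set: for such a point, the representation of
  \<open>\<Lambda>(- ln |z\<^sub>1|, ..., - ln |z\<^sub>m|)\<close> provides the rescaling into \<open>Z\<^sub>K\<close>. So it is a homeomorphism, and it
  is equivariant because the torus commutes with rescaling and preserves \<open>Z\<^sub>K\<close>.

  For the smooth structure, let \<open>J \<in> K\<close> have \<open>n\<close> elements. The \<open>a\<^sub>i\<close> with \<open>i \<in> J\<close> form a basis, so a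
  kernel vector is determined by its coordinates outside \<open>J\<close>, which are arbitrary. Hence each orbit
  in \<open>{z. z\<^sub>j \<noteq> 0 for j \<notin> J}\<close> has exactly one point with \<open>|z\<^sub>j| = 1\<close> for \<open>j \<notin> J\<close>, and the orbits are
  parametrized by \<open>\<complex>\<^sup>J\<close> times a product of \<open>m - n\<close> circles, of dimension \<open>2n + (m - n) = m + n\<close>. With stereographic
  coordinates on the circles the charts and their inverse sections become explicit smooth maps
  built from rational functions and real powers (locale \<open>fan_chart\<close>). Charts obtained from smooth
  invariant maps with smooth sections automatically have smooth transition maps, and the projection
  is a submersion (\<open>slice\<close>).
\<close>

section \<open>Calculus of smooth maps\<close>

lemma C_k_on_cong:
  assumes "open S" "\<And>x. x \<in> S \<Longrightarrow> f x = g x" "C_k_on k f S"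
  shows "C_k_on k g S"
  using assms(2,3)
proof (induction k arbitrary: f g)
  case 0
  then show ?case by (simp cong: continuous_on_cong)
next
  case (Suc k)
  have diff: "f differentiable (at x)" if "x \<in> S" for x
    using Suc.prems(2) that by simp
  have "g differentiable (at x)" if "x \<in> S" for x
    using diff[OF that] has_derivative_transform_within_open[OF _ assms(1) that, of f _ UNIV g] Suc.prems(1)
    unfolding differentiable_def by blast
  moreover have "C_k_on k (\<lambda>x. frechet_derivative g (at x) v) S" for v
  proof (rule Suc.IH)
    show "C_k_on k (\<lambda>x. frechet_derivative f (at x) v) S"
      using Suc.prems(2) by simp
    show "frechet_derivative f (at x) v = frechet_derivative g (at x) v" if "x \<in> S" for x
      using frechet_derivative_transform_within_open[OF diff[OF that] assms(1) that Suc.prems(1)]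
      by simp
  qed
  ultimately show ?case by simp
qed

text \<open>This introduction rule lets a \<open>C\<^sup>k\<close> proof work with an explicit formula for the derivative in
  place of \<^const>\<open>frechet_derivative\<close>, which is defined by choice.\<close>

lemma C_k_on_SucI:
  assumes "open S" "\<And>x. x \<in> S \<Longrightarrow> (f has_derivative f' x) (at x)"
    and "\<And>v. C_k_on k (\<lambda>x. f' x v) S"
  shows "C_k_on (Suc k) f S"
proof -
  have eq: "f' x = frechet_derivative f (at x)" if "x \<in> S" for x
    using assms(2)[OF that] by (rule frechet_derivative_at)
  have "C_k_on k (\<lambda>x. frechet_derivative f (at x) v) S" for v
    by (rule C_k_on_cong[OF assms(1) _ assms(3)]) (simp add: eq)
  then show ?thesis
    using assms(2) by (auto simp: differentiable_def)
qed

lemma C_k_on_SucD: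
  assumes "C_k_on (Suc k) f S"
  shows "C_k_on k f S"
  using assms
proof (induction k arbitrary: f)
  case 0
  then have "f differentiable (at x within S)" if "x \<in> S" for x
    using that by (auto intro: differentiable_at_withinI)
  then show ?case
    by (auto intro!: differentiable_imp_continuous_on simp: differentiable_on_def)
next
  case (Suc k)
  then show ?case by (metis C_k_on.simps(2))
qed

lemma C_k_on_subset:
  assumes "C_k_on k f S" "T \<subseteq> S"
  shows "C_k_on k f T"
  using assms(1) by (induction k arbitrary: f) (use assms(2) continuous_on_subset in auto)

lemma C_k_on_const: "C_k_on k (\<lambda>x. c) S"
  by (induction k arbitrary: c) auto

lemma C_k_on_linear:
  assumes "open S" "bounded_linear f"
  shows "C_k_on k f S"
proof (cases k)
  case 0
  then show ?thesis
    using assms by (simp add: linear_continuous_on)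
next
  case (Suc j)
  show ?thesis
    unfolding Suc
    by (rule C_k_on_SucI[OF assms(1) bounded_linear_imp_has_derivative[OF assms(2)] C_k_on_const])
qed

lemma C_k_on_add:
  assumes "open S" "C_k_on k f S" "C_k_on k g S"
  shows "C_k_on k (\<lambda>x. f x + g x) S"
  using assms(2,3)
proof (induction k arbitrary: f g)
  case 0
  then show ?case by (simp add: continuous_on_add)
next
  case (Suc k)
  show ?case
  proof (rule C_k_on_SucI[OF assms(1)])
    fix x assume "x \<in> S"
    then show "((\<lambda>x. f x + g x) has_derivative
        (\<lambda>v. frechet_derivative f (at x) v + frechet_derivative g (at x) v)) (at x)"
      using Suc.prems by (intro has_derivative_add) (auto simp: frechet_derivative_works)
  next
    fix v show "C_k_on k (\<lambda>x. frechet_derivative f (at x) v + frechet_derivative g (at x) v) S"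
      using Suc by simp
  qed
qed

lemma C_k_on_sum:
  assumes "open S" "\<And>i. i \<in> I \<Longrightarrow> C_k_on k (f i) S"
  shows "C_k_on k (\<lambda>x. \<Sum>i\<in>I. f i x) S"
  using assms(2)
  by (induction I rule: infinite_finite_induct) (auto intro: C_k_on_const C_k_on_add assms(1))

lemma C_k_on_scaleR:
  assumes "open S" "C_k_on k f S" "C_k_on k g S"
  shows "C_k_on k (\<lambda>x. f x *\<^sub>R g x) S"
  using assms(2,3)
proof (induction k arbitrary: f g)
  case 0
  then show ?case by (simp add: continuous_on_scaleR)
next
  case (Suc k)
  show ?case
  proof (rule C_k_on_SucI[OF assms(1)])
    fix x assume "x \<in> S"
    then show "((\<lambda>x. f x *\<^sub>R g x) has_derivative
        (\<lambda>v. f x *\<^sub>R frechet_derivative g (at x) v + frechet_derivative f (at x) v *\<^sub>R g x)) (at x)"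
      using Suc.prems by (intro has_derivative_scaleR) (auto simp: frechet_derivative_works)
  next
    fix v show "C_k_on k (\<lambda>x. f x *\<^sub>R frechet_derivative g (at x) v
        + frechet_derivative f (at x) v *\<^sub>R g x) S"
      by (intro C_k_on_add[OF assms(1)] Suc.IH) (use Suc.prems C_k_on_SucD in auto)
  qed
qed

lemma C_k_on_inner:
  assumes "open S" "C_k_on k f S"
  shows "C_k_on k (\<lambda>x. f x \<bullet> b) S"
  using assms(2)
proof (induction k arbitrary: f)
  case 0
  then show ?case by (auto intro!: continuous_intros)
next
  case (Suc k)
  show ?case
  proof (rule C_k_on_SucI[OF assms(1)])
    fix x assume "x \<in> S"
    then show "((\<lambda>x. f x \<bullet> b) has_derivative (\<lambda>v. frechet_derivative f (at x) v \<bullet> b)) (at x)"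
      using Suc.prems by (intro has_derivative_inner_left) (auto simp: frechet_derivative_works)
  qed (use Suc in auto)
qed

text \<open>The directional derivative of \<open>g \<circ> f\<close> along \<open>v\<close> is the sum, over a basis, of products of a
  component of \<open>D\<^sub>v f\<close> with a directional derivative of \<open>g\<close> composed with \<open>f\<close>; so the induction
  closes once products are known to be of class \<open>C\<^sup>k\<close>.\<close>

lemma C_k_on_compose:
  fixes f :: "'a::euclidean_space \<Rightarrow> 'b::euclidean_space"
    and g :: "'b \<Rightarrow> 'c::euclidean_space"
  assumes "open S" "f ` S \<subseteq> T" "C_k_on k g T" "C_k_on k f S"
  shows "C_k_on k (\<lambda>x. g (f x)) S"
  using assms(3,4)
proof (induction k arbitrary: g)
  case 0
  then show ?case
    using assms(2) continuous_on_compose2 by (metis C_k_on.simps(1))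
next
  case (Suc k)
  define Df where "Df x = frechet_derivative f (at x)" for x
  define Dg where "Dg y = frechet_derivative g (at y)" for y
  have f: "(f has_derivative Df x) (at x)" if "x \<in> S" for x
    using Suc.prems(2) that by (auto simp: Df_def frechet_derivative_works)
  have g: "(g has_derivative Dg (f x)) (at (f x))" if "x \<in> S" for x
    using Suc.prems(1) assms(2) that by (auto simp: Dg_def frechet_derivative_works)
  show ?case
  proof (rule C_k_on_SucI[OF assms(1)])
    fix x assume x: "x \<in> S"
    interpret Dg: bounded_linear "Dg (f x)"
      using g[OF x] by (rule has_derivative_bounded_linear)
    have "Dg (f x) (Df x v) = (\<Sum>b\<in>Basis. (Df x v \<bullet> b) *\<^sub>R Dg (f x) b)" for v
      by (subst euclidean_representation[of "Df x v", symmetric])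
         (simp only: Dg.sum Dg.scaleR)
    then show "((\<lambda>x. g (f x)) has_derivative
        (\<lambda>v. \<Sum>b\<in>Basis. (Df x v \<bullet> b) *\<^sub>R Dg (f x) b)) (at x)"
      using has_derivative_compose[OF f[OF x] g[OF x]] by simp
  next
    fix v
    have inner: "C_k_on k (\<lambda>x. Df x v \<bullet> b) S" for b
      using Suc.prems(2) by (intro C_k_on_inner[OF assms(1)]) (simp add: Df_def)
    have "C_k_on k (\<lambda>y. Dg y b) T" for b
      using Suc.prems(1) by (simp add: Dg_def)
    then have "C_k_on k (\<lambda>x. Dg (f x) b) S" for b
      using Suc.IH[of "\<lambda>y. Dg y b"] Suc.prems(2) C_k_on_SucD by blast
    then show "C_k_on k (\<lambda>x. \<Sum>b\<in>Basis. (Df x v \<bullet> b) *\<^sub>R Dg (f x) b) S"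
      using inner by (intro C_k_on_sum C_k_on_scaleR assms(1))
  qed
qed

text \<open>Differentiating a real power gives another one, so the induction is over all exponents at once.
  Reciprocals and absolute values, which occur in the charts, reduce to this case.\<close>

lemma C_k_on_powr: "C_k_on k (\<lambda>x::real. x powr r) {0<..}"
proof (induction k arbitrary: r)
  case 0
  then show ?case by (auto intro!: continuous_intros)
next
  case (Suc k)
  show ?case
  proof (rule C_k_on_SucI)
    fix x :: real assume "x \<in> {0<..}"
    then have "((\<lambda>x. x powr r) has_real_derivative r * x powr (r - 1)) (at x)"
      by (auto intro!: has_real_derivative_powr)
    then show "((\<lambda>x. x powr r) has_derivative (\<lambda>v. x powr (r - 1) *\<^sub>R (v * r))) (at x)"
      unfolding has_field_derivative_def by (rule has_derivative_eq_rhs) (simp add: fun_eq_iff)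
  next
    fix v show "C_k_on k (\<lambda>x. x powr (r - 1) *\<^sub>R (v * r)) {0<..}"
      by (intro C_k_on_scaleR Suc C_k_on_const) auto
  qed auto
qed

lemma smooth_on_cong:
  assumes "open S" "\<And>x. x \<in> S \<Longrightarrow> f x = g x" "smooth_on f S"
  shows "smooth_on g S"
  using assms C_k_on_cong unfolding smooth_on_def by blast

lemma smooth_on_subset: "smooth_on f S \<Longrightarrow> T \<subseteq> S \<Longrightarrow> smooth_on f T"
  using C_k_on_subset unfolding smooth_on_def by blast

lemma smooth_on_differentiable:
  assumes "smooth_on f S" "x \<in> S"
  shows "f differentiable (at x)"
  using assms unfolding smooth_on_def by (metis C_k_on.simps(2))

lemma smooth_on_continuous: "smooth_on f S \<Longrightarrow> continuous_on S f"
  unfolding smooth_on_def by (metis C_k_on.simps(1))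

lemma smooth_on_const: "smooth_on (\<lambda>x. c) S"
  by (simp add: smooth_on_def C_k_on_const)

lemma smooth_on_compose:
  assumes "open S" "f ` S \<subseteq> T" "smooth_on g T" "smooth_on f S"
  shows "smooth_on (\<lambda>x. g (f x)) S"
  using assms C_k_on_compose unfolding smooth_on_def by blast

lemma smooth_on_linear: "open S \<Longrightarrow> bounded_linear f \<Longrightarrow> smooth_on f S"
  by (simp add: smooth_on_def C_k_on_linear)

lemma smooth_on_linear_compose:
  assumes "open S" "bounded_linear g" "smooth_on f S"
  shows "smooth_on (\<lambda>x. g (f x)) S"
  by (rule smooth_on_compose[OF assms(1) _ smooth_on_linear[OF open_UNIV assms(2)] assms(3)]) simp

lemma smooth_on_add:
  "open S \<Longrightarrow> smooth_on f S \<Longrightarrow> smooth_on g S \<Longrightarrow> smooth_on (\<lambda>x. f x + g x) S"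
  by (simp add: smooth_on_def C_k_on_add)

lemma smooth_on_sum:
  "open S \<Longrightarrow> (\<And>i. i \<in> I \<Longrightarrow> smooth_on (f i) S) \<Longrightarrow> smooth_on (\<lambda>x. \<Sum>i\<in>I. f i x) S"
  by (simp add: smooth_on_def C_k_on_sum)

lemma smooth_on_scaleR:
  "open S \<Longrightarrow> smooth_on f S \<Longrightarrow> smooth_on g S \<Longrightarrow> smooth_on (\<lambda>x. f x *\<^sub>R g x) S"
  by (simp add: smooth_on_def C_k_on_scaleR)

lemma smooth_on_mult:
  fixes f g :: "'a::euclidean_space \<Rightarrow> real"
  shows "open S \<Longrightarrow> smooth_on f S \<Longrightarrow> smooth_on g S \<Longrightarrow> smooth_on (\<lambda>x. f x * g x) S"
  using smooth_on_scaleR[of S f g] by simp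

lemma smooth_on_diff:
  assumes "open S" "smooth_on f S" "smooth_on g S"
  shows "smooth_on (\<lambda>x. f x - g x) S"
  using smooth_on_add[OF assms(1,2) smooth_on_scaleR[OF assms(1) smooth_on_const[of "-1"] assms(3)]]
  by simp

lemma smooth_on_prod:
  fixes f :: "'i \<Rightarrow> 'a::euclidean_space \<Rightarrow> real"
  assumes "open S" "\<And>i. i \<in> I \<Longrightarrow> smooth_on (f i) S"
  shows "smooth_on (\<lambda>x. \<Prod>i\<in>I. f i x) S"
  using assms(2)
  by (induction I rule: infinite_finite_induct) (auto intro: smooth_on_const smooth_on_mult assms(1))

lemma smooth_on_powr:
  fixes f :: "'a::euclidean_space \<Rightarrow> real"
  assumes "open S" "smooth_on f S" "\<And>x. x \<in> S \<Longrightarrow> 0 < f x"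
  shows "smooth_on (\<lambda>x. f x powr r) S"
proof (rule smooth_on_compose[OF assms(1), of f "{0<..}" "\<lambda>y. y powr r"])
  show "smooth_on (\<lambda>y::real. y powr r) {0<..}"
    by (simp add: smooth_on_def C_k_on_powr)
qed (use assms in auto)

text \<open>A positive denominator can be moved to the numerator as a real power.\<close>

lemma smooth_on_divide:
  fixes f g :: "'a::euclidean_space \<Rightarrow> real"
  assumes "open S" "smooth_on f S" "smooth_on g S" "\<And>x. x \<in> S \<Longrightarrow> 0 < g x"
  shows "smooth_on (\<lambda>x. f x / g x) S"
proof (rule smooth_on_cong[OF assms(1)])
  show "smooth_on (\<lambda>x. f x * g x powr - 1) S"
    by (intro smooth_on_mult smooth_on_powr assms)
  show "f x * g x powr - 1 = f x / g x" if "x \<in> S" for x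
    using assms(4)[OF that] by (simp add: powr_minus divide_inverse)
qed

lemma smooth_on_norm_complex:
  fixes f :: "'a::euclidean_space \<Rightarrow> complex"
  assumes "open S" "smooth_on f S" "\<And>x. x \<in> S \<Longrightarrow> f x \<noteq> 0"
  shows "smooth_on (\<lambda>x. norm (f x)) S"
proof (rule smooth_on_cong[OF assms(1)])
  show "smooth_on (\<lambda>x. (Re (f x) * Re (f x) + Im (f x) * Im (f x)) powr (1/2)) S"
    by (intro smooth_on_powr smooth_on_add smooth_on_mult assms(1)
        smooth_on_linear_compose[OF _ bounded_linear_Re]
        smooth_on_linear_compose[OF _ bounded_linear_Im] assms(2))
       (use assms(3) in \<open>auto simp: complex_eq_iff sum_squares_gt_zero_iff\<close>)
  show "(Re (f x) * Re (f x) + Im (f x) * Im (f x)) powr (1/2) = norm (f x)" for x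
    by (simp add: norm_complex_def powr_half_sqrt power2_eq_square)
qed

lemma smooth_on_complexI:
  assumes "open S" "smooth_on (\<lambda>x. Re (f x)) S" "smooth_on (\<lambda>x. Im (f x)) S"
  shows "smooth_on f S"
proof (rule smooth_on_cong[OF assms(1)])
  show "smooth_on (\<lambda>x. Re (f x) *\<^sub>R 1 + Im (f x) *\<^sub>R \<i>) S"
    by (intro smooth_on_add smooth_on_scaleR smooth_on_const assms)
qed (rule complex_eqI; simp)

lemma smooth_on_vecI:
  fixes f :: "'a::euclidean_space \<Rightarrow> 'b::euclidean_space ^ 'k::finite"
  assumes "open S" "\<And>i. smooth_on (\<lambda>x. f x $ i) S"
  shows "smooth_on f S"
proof (rule smooth_on_cong[OF assms(1)])
  have "linear (axis i :: 'b \<Rightarrow> 'b ^ 'k)" for i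
    by (rule linearI) (auto simp: axis_def vec_eq_iff)
  then have "smooth_on (\<lambda>x. axis i (f x $ i)) S" for i
    by (intro smooth_on_linear_compose[OF assms(1) _ assms(2)])
       (simp add: linear_conv_bounded_linear)
  then show "smooth_on (\<lambda>x. \<Sum>i\<in>UNIV. axis i (f x $ i)) S"
    by (intro smooth_on_sum assms(1))
  show "(\<Sum>i\<in>UNIV. axis i (f x $ i)) = f x" for x
    by (simp add: vec_eq_iff axis_def)
qed

lemma smooth_on_nth: "open S \<Longrightarrow> smooth_on (\<lambda>x. x $ i) S"
  by (intro smooth_on_linear bounded_linear_vec_nth)

section \<open>Faces of polyhedral cones\<close>

lemma convex_cone_hull_image:
  fixes f :: "'i \<Rightarrow> 'a::euclidean_space"
  assumes "finite I"
  shows "convex_cone hull (f ` I) = {x. \<exists>c. (\<forall>i\<in>I. 0 \<le> c i) \<and> x = (\<Sum>i\<in>I. c i *\<^sub>R f i)}"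
    (is "_ = ?C")
proof
  have "convex_cone ?C"
    unfolding convex_cone_iff
  proof (intro conjI ballI allI impI)
    show "0 \<in> ?C" by (auto intro!: exI[of _ "\<lambda>_. 0"])
  next
    fix x y assume "x \<in> ?C" "y \<in> ?C"
    then obtain c d where "\<forall>i\<in>I. 0 \<le> c i" "x = (\<Sum>i\<in>I. c i *\<^sub>R f i)"
      "\<forall>i\<in>I. 0 \<le> d i" "y = (\<Sum>i\<in>I. d i *\<^sub>R f i)" by blast
    then show "x + y \<in> ?C"
      by (auto intro!: exI[of _ "\<lambda>i. c i + d i"] simp: scaleR_add_left sum.distrib)
  next
    fix x and r :: real assume "x \<in> ?C" "0 \<le> r"
    then obtain c where "\<forall>i\<in>I. 0 \<le> c i" "x = (\<Sum>i\<in>I. c i *\<^sub>R f i)" by blast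
    then show "r *\<^sub>R x \<in> ?C" using \<open>0 \<le> r\<close>
      by (auto intro!: exI[of _ "\<lambda>i. r * c i"] simp: scaleR_sum_right)
  qed
  moreover have "f ` I \<subseteq> ?C"
  proof clarify
    fix i assume i: "i \<in> I"
    have "(\<Sum>j\<in>I. (if j = i then 1 else 0) *\<^sub>R f j) = (\<Sum>j\<in>I. if j = i then f i else 0)"
      by (rule sum.cong) auto
    then show "\<exists>c. (\<forall>i\<in>I. 0 \<le> c i) \<and> f i = (\<Sum>i\<in>I. c i *\<^sub>R f i)"
      using assms i by (intro exI[of _ "\<lambda>j. if j = i then 1 else 0"]) simp
  qed
  ultimately show "convex_cone hull (f ` I) \<subseteq> ?C"
    by (simp add: hull_minimal)
next
  show "?C \<subseteq> convex_cone hull (f ` I)"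
  proof clarify
    fix c :: "'i \<Rightarrow> real" assume c: "\<forall>i\<in>I. 0 \<le> c i"
    have "(\<Sum>i\<in>J. c i *\<^sub>R f i) \<in> convex_cone hull (f ` I)" if "J \<subseteq> I" for J
      using finite_subset[OF that assms] that
    proof (induction J)
      case empty
      then show ?case by (simp add: convex_cone_hull_contains_0)
    next
      case (insert j J)
      then show ?case
        using c convex_cone_hull_add[OF convex_cone_hull_mul[OF hull_inc, of "f j"]] by simp
    qed
    then show "(\<Sum>i\<in>I. c i *\<^sub>R f i) \<in> convex_cone hull (f ` I)" by blast
  qed
qed

lemma convex_cone_hull_finite:
  fixes S :: "'a::euclidean_space set"
  assumes "finite S"
  shows "convex_cone hull S = {x. \<exists>c. (\<forall>s\<in>S. 0 \<le> c s) \<and> x = (\<Sum>s\<in>S. c s *\<^sub>R s)}"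
  using convex_cone_hull_image[OF assms, of id] by simp

lemma linear_combination_nonzero:
  fixes f :: "'i \<Rightarrow> 'a::real_vector"
  assumes "(\<Sum>i\<in>I. c i *\<^sub>R f i) \<noteq> 0"
  shows "\<exists>i\<in>I. c i \<noteq> 0"
proof (rule ccontr)
  assume "\<not> (\<exists>i\<in>I. c i \<noteq> 0)"
  then have "(\<Sum>i\<in>I. c i *\<^sub>R f i) = 0" by (intro sum.neutral) auto
  then show False using assms by blast
qed

lemma convex_cone_hull_singleton: "convex_cone hull {v} = {c *\<^sub>R v | c. 0 \<le> c}"
  for v :: "'a::euclidean_space"
  by (subst convex_cone_hull_finite) (auto intro: exI[of _ "\<lambda>_. _"])

text \<open>The point \<open>y + w\<close> is the midpoint of \<open>2y\<close> and \<open>2w\<close>, which lie in the cone. Stating the conclusion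
  for \<open>2y\<close> avoids showing first that a face of a cone is itself conic.\<close>

lemma face_of_convex_cone_summand:
  fixes C :: "'a::euclidean_space set"
  assumes "F face_of C" "convex_cone C" "y \<in> C" "w \<in> C" "y + w \<in> F"
  shows "2 *\<^sub>R y \<in> F"
proof (cases "y = w")
  case True
  then show ?thesis using assms(5) by (simp add: scaleR_2)
next
  case False
  have "y + w \<in> open_segment (2 *\<^sub>R y) (2 *\<^sub>R w)"
    using False by (auto simp: in_segment intro!: exI[of _ "1/2"])
  moreover have "2 *\<^sub>R y \<in> C" "2 *\<^sub>R w \<in> C"
    using assms(2-4) by (auto intro: convex_cone_scaleR)
  ultimately show ?thesis
    using face_ofD[OF assms(1)] assms(5) by blast
qed

text \<open>A generator used with positive weight by a point of a face belongs to that face, up to scaling.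
  The cone \<open>D\<close> absorbs the scaling; in the applications it is a ray, or another cone of the fan.\<close>

lemma face_of_convex_cone_hull_generator:
  fixes f :: "'i \<Rightarrow> 'a::euclidean_space"
  assumes F: "F face_of convex_cone hull (f ` I)" and I: "finite I"
    and c: "\<And>i. i \<in> I \<Longrightarrow> 0 \<le> c i" and x: "(\<Sum>i\<in>I. c i *\<^sub>R f i) \<in> F"
    and j: "j \<in> I" "0 < c j" and cone: "F \<subseteq> D" "convex_cone D"
  shows "f j \<in> D"
proof -
  have mem: "(\<Sum>i\<in>J. c i *\<^sub>R f i) \<in> convex_cone hull (f ` I)" if "J \<subseteq> I" for J
  proof -
    have "(\<Sum>i\<in>J. c i *\<^sub>R f i) \<in> convex_cone hull (f ` J)"
      using that c by (subst convex_cone_hull_image) (auto intro: finite_subset[OF _ I])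
    then show ?thesis
      using hull_mono[of "f ` J" "f ` I" convex_cone] that by blast
  qed
  have "c j *\<^sub>R f j \<in> convex_cone hull (f ` I)"
    using mem[of "{j}"] j by simp
  moreover have "(\<Sum>i\<in>I - {j}. c i *\<^sub>R f i) \<in> convex_cone hull (f ` I)"
    by (rule mem) auto
  moreover have "c j *\<^sub>R f j + (\<Sum>i\<in>I - {j}. c i *\<^sub>R f i) \<in> F"
    using x j I by (simp add: sum.remove)
  ultimately have "2 *\<^sub>R (c j *\<^sub>R f j) \<in> F"
    using face_of_convex_cone_summand[OF F convex_cone_convex_cone_hull] by blast
  then have "2 *\<^sub>R (c j *\<^sub>R f j) \<in> D"
    using cone(1) by blast
  then show ?thesis
    using convex_cone_scaleR[OF cone(2), of "1 / (2 * c j)"] j(2) by fastforce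
qed

lemma face_of_simplicial_cone:
  fixes S :: "'a::euclidean_space set"
  assumes S: "independent S" and T: "T \<subseteq> S"
  shows "(convex_cone hull T) face_of (convex_cone hull S)"
proof -
  have fin: "finite S" "finite T"
    using S T independent_imp_finite finite_subset by auto
  \<comment> \<open>The coordinates outside \<open>T\<close> are nonnegative on the large cone and vanish exactly on the
    small one.\<close>
  have T_iff: "(\<Sum>s\<in>S. c s *\<^sub>R s) \<in> convex_cone hull T \<longleftrightarrow> (\<forall>s\<in>S - T. c s = 0)"
    if c: "\<forall>s\<in>S. 0 \<le> c s" for c
  proof
    assume "(\<Sum>s\<in>S. c s *\<^sub>R s) \<in> convex_cone hull T"
    then obtain d where "(\<Sum>s\<in>S. c s *\<^sub>R s) = (\<Sum>s\<in>T. d s *\<^sub>R s)"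
      using convex_cone_hull_finite[OF fin(2)] by auto
    also have "\<dots> = (\<Sum>s\<in>S. (if s \<in> T then d s else 0) *\<^sub>R s)"
      using fin T by (intro sum.mono_neutral_cong_left) auto
    finally have "(\<Sum>s\<in>S. (c s - (if s \<in> T then d s else 0)) *\<^sub>R s) = 0"
      by (simp add: scaleR_diff_left sum_subtractf)
    then have "c s - (if s \<in> T then d s else 0) = 0" if "s \<in> S" for s
      using independentD[OF S fin(1) order_refl, of "\<lambda>s. c s - (if s \<in> T then d s else 0)" s] that
      by blast
    then show "\<forall>s\<in>S - T. c s = 0" by fastforce
  next
    assume "\<forall>s\<in>S - T. c s = 0"
    then have "(\<Sum>s\<in>S. c s *\<^sub>R s) = (\<Sum>s\<in>T. c s *\<^sub>R s)"
      using fin T by (intro sum.mono_neutral_right) auto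
    then show "(\<Sum>s\<in>S. c s *\<^sub>R s) \<in> convex_cone hull T"
      using c T convex_cone_hull_finite[OF fin(2)] by auto
  qed
  show ?thesis
    unfolding face_of_def
  proof (intro conjI ballI impI)
    show "convex_cone hull T \<subseteq> convex_cone hull S"
      using T by (rule hull_mono)
    show "convex (convex_cone hull T)"
      by (rule convex_convex_cone_hull)
  next
    fix x y z assume "x \<in> convex_cone hull S" "y \<in> convex_cone hull S"
      and z: "z \<in> convex_cone hull T" and seg: "z \<in> open_segment x y"
    then obtain c d where c: "\<forall>s\<in>S. 0 \<le> c s" "x = (\<Sum>s\<in>S. c s *\<^sub>R s)"
      and d: "\<forall>s\<in>S. 0 \<le> d s" "y = (\<Sum>s\<in>S. d s *\<^sub>R s)"
      using convex_cone_hull_finite[OF fin(1)] by auto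
    obtain u where u: "0 < u" "u < 1" "z = (1 - u) *\<^sub>R x + u *\<^sub>R y"
      using seg by (auto simp: in_segment)
    have "z = (\<Sum>s\<in>S. ((1 - u) * c s + u * d s) *\<^sub>R s)"
      by (simp add: u c d scaleR_sum_right scaleR_add_left sum.distrib)
    moreover have "\<forall>s\<in>S. 0 \<le> (1 - u) * c s + u * d s"
      using u c d by simp
    ultimately have "\<forall>s\<in>S - T. (1 - u) * c s + u * d s = 0"
      using T_iff z by simp
    then have "\<forall>s\<in>S - T. c s = 0 \<and> d s = 0"
      using u c d by (simp add: add_nonneg_eq_0_iff)
    then show "x \<in> convex_cone hull T" "y \<in> convex_cone hull T"
      using T_iff c d by auto
  qed
qed

section \<open>Simplicial fans and their generators\<close>

locale simplicial_ray_fan =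
  fixes \<Sigma> :: "'a::euclidean_space set set" and a :: "'m::finite \<Rightarrow> 'a"
  assumes simplicial: "simplicial_fan \<Sigma>" and rays: "ray_generators \<Sigma> a"
begin

lemma is_fan: "fan \<Sigma>"
  using simplicial by (simp add: simplicial_fan_def)

lemma face_in_fan: "\<sigma> \<in> \<Sigma> \<Longrightarrow> \<tau> face_of \<sigma> \<Longrightarrow> \<tau> \<noteq> {} \<Longrightarrow> \<tau> \<in> \<Sigma>"
  using is_fan unfolding fan_def by blast

lemma ray_in_fan: "convex_cone hull {a i} \<in> \<Sigma>"
  using rays by (auto simp: ray_generators_def bij_betw_def)

lemma generator_nonzero: "a i \<noteq> 0"
proof
  assume "a i = 0"
  then have "convex_cone hull {a i} = {0}"
    by (auto simp: convex_cone_hull_singleton)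
  then have "dim (convex_cone hull {a i}) = 0"
    by simp
  moreover have "dim (convex_cone hull {a i}) = 1"
    using rays by (auto simp: ray_generators_def bij_betw_def)
  ultimately show False by simp
qed

text \<open>Distinct indices label distinct rays, and a ray is determined by any nonzero vector on it.\<close>

lemma generator_in_ray_eq:
  assumes "a j \<in> convex_cone hull {a i}"
  shows "i = j"
proof -
  obtain c where c: "0 \<le> c" "a j = c *\<^sub>R a i"
    using assms by (auto simp: convex_cone_hull_singleton)
  then have "0 < c"
    using generator_nonzero[of j] by (cases "c = 0") auto
  then have "convex_cone hull {a i} = convex_cone hull {a j}"
  proof -
    have "b *\<^sub>R a i = (b / c) *\<^sub>R a j" for b
      using \<open>0 < c\<close> c by simp
    moreover have "b *\<^sub>R a j = (b * c) *\<^sub>R a i" for b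
      using c by simp
    ultimately show ?thesis
      unfolding convex_cone_hull_singleton
      using \<open>0 < c\<close> by (smt (verit) Collect_cong divide_nonneg_pos mult_nonneg_nonneg)
  qed
  then show ?thesis
    using rays by (auto simp: ray_generators_def bij_betw_def dest: injD)
qed

text \<open>The ray through \<open>a\<^sub>i\<close> is its own intersection with \<open>\<sigma>\<close>, and cones of a fan meet in common
  faces.\<close>

lemma ray_face_of_cone:
  assumes "\<sigma> \<in> \<Sigma>" "a i \<in> \<sigma>"
  shows "(convex_cone hull {a i}) face_of \<sigma>"
proof -
  have "convex_cone \<sigma>"
    using is_fan assms(1) by (auto simp: fan_def polyhedral_cone_def convex_cone_convex_cone_hull)
  then have "convex_cone hull {a i} \<subseteq> \<sigma>"
    using assms(2) by (simp add: hull_minimal)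
  moreover have "(convex_cone hull {a i} \<inter> \<sigma>) face_of \<sigma>"
    using is_fan assms(1) ray_in_fan by (auto simp: fan_def)
  ultimately show ?thesis by (simp add: inf.absorb1)
qed

text \<open>An extreme ray cannot be a positive combination of others: some \<open>a\<^sub>j\<close> with \<open>j \<in> I\<close> occurs in \<open>a\<^sub>i\<close> with
  positive weight, so it lies on the face spanned by \<open>a\<^sub>i\<close>, whence \<open>j = i\<close>.\<close>

lemma generator_in_cone_index:
  assumes "convex_cone hull (a ` I) \<in> \<Sigma>" "a i \<in> convex_cone hull (a ` I)"
  shows "i \<in> I"
proof -
  obtain c where c: "\<forall>j\<in>I. 0 \<le> c j" "a i = (\<Sum>j\<in>I. c j *\<^sub>R a j)"
    using assms(2) convex_cone_hull_image[of I a] by auto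
  obtain j where j: "j \<in> I" "c j \<noteq> 0"
    using linear_combination_nonzero[of c a I] generator_nonzero[of i] c(2) by auto
  have "a j \<in> convex_cone hull {a i}"
  proof (rule face_of_convex_cone_hull_generator[OF ray_face_of_cone[OF assms], of c])
    show "(\<Sum>j\<in>I. c j *\<^sub>R a j) \<in> convex_cone hull {a i}"
      unfolding c(2)[symmetric] by (simp add: hull_inc)
    show "0 < c j" using j c(1) by fastforce
  qed (use c j convex_cone_convex_cone_hull in auto)
  then show ?thesis
    using generator_in_ray_eq j by blast
qed

text \<open>If \<open>\<Lambda>(u) = 0\<close>, the positive and the negative part of \<open>u\<close> represent the same point in two
  cones of the fan. Every \<open>a\<^sub>i\<close> used by the positive part then lies in the intersection, a face,
  hence in the other cone, and so it is used by the negative part as well: impossible.\<close>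

lemma no_positive_part:
  assumes u: "Lambda_R a u = 0"
    and P: "{i. 0 < u $ i} \<in> underlying_complex \<Sigma> a"
    and N: "{i. u $ i < 0} \<in> underlying_complex \<Sigma> a"
  shows "u $ i \<le> 0"
proof (rule ccontr)
  assume "\<not> u $ i \<le> 0"
  then have i: "i \<in> {i. 0 < u $ i}" by simp
  let ?P = "convex_cone hull (a ` {i. 0 < u $ i})"
  let ?N = "convex_cone hull (a ` {i. u $ i < 0})"
  have cones: "?P \<in> \<Sigma>" "?N \<in> \<Sigma>"
    using P N by (auto simp: underlying_complex_def)
  let ?x = "\<Sum>i | 0 < u $ i. (u $ i) *\<^sub>R a i"
  have "0 = (\<Sum>i\<in>UNIV. u $ i *\<^sub>R a i)"
    using u by (simp add: Lambda_R_def)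
  also have "\<dots> = (\<Sum>i\<in>{i. 0 < u $ i} \<union> {i. u $ i < 0}. u $ i *\<^sub>R a i)"
    by (rule sum.mono_neutral_right) auto
  also have "\<dots> = ?x + (\<Sum>i | u $ i < 0. u $ i *\<^sub>R a i)"
    by (rule sum.union_disjoint) auto
  finally have "?x = (\<Sum>i | u $ i < 0. (- (u $ i)) *\<^sub>R a i)"
    by (simp add: sum_negf eq_neg_iff_add_eq_0)
  also have "\<dots> \<in> ?N"
    by (subst convex_cone_hull_image) (auto intro!: exI[of _ "\<lambda>i. - (u $ i)"])
  finally have "?x \<in> ?N" .
  moreover have "?x \<in> ?P"
    by (subst convex_cone_hull_image) (auto intro!: exI[of _ "\<lambda>i. u $ i"])
  moreover have "(?P \<inter> ?N) face_of ?P"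
    using is_fan cones by (auto simp: fan_def)
  ultimately have "a i \<in> ?N"
    using i by (intro face_of_convex_cone_hull_generator[of "?P \<inter> ?N" a "{i. 0 < u $ i}" "\<lambda>i. u $ i"])
      (auto simp: convex_cone_convex_cone_hull)
  then have "i \<in> {i. u $ i < 0}"
    using cones(2) generator_in_cone_index by blast
  then show False using i by simp
qed

lemma kernel_support_unique:
  assumes u: "Lambda_R a u = 0"
    and P: "{i. 0 < u $ i} \<in> underlying_complex \<Sigma> a"
    and N: "{i. u $ i < 0} \<in> underlying_complex \<Sigma> a"
  shows "u = 0"
proof -
  have "Lambda_R a (- u) = 0"
    using u by (simp add: Lambda_R_def sum_negf)
  then have "(- u) $ i \<le> 0" for i
    by (rule no_positive_part) (use P N in auto)
  moreover have "u $ i \<le> 0" for i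
    using assms by (rule no_positive_part)
  ultimately show ?thesis
    by (simp add: vec_eq_iff order_antisym)
qed

text \<open>The edges of a simplicial cone are faces, hence rays of the fan, so the basis vectors that
  generate the cone are the chosen generators up to positive factors.\<close>

lemma simplicial_generator_ray:
  assumes S: "independent S" and \<sigma>: "convex_cone hull S \<in> \<Sigma>" and s: "s \<in> S"
  obtains i where "convex_cone hull {s} = convex_cone hull {a i}" "a i \<in> convex_cone hull S"
proof -
  have sub: "convex_cone hull {s} \<subseteq> convex_cone hull S"
    using s by (intro hull_mono) auto
  have "convex_cone hull {s} \<in> \<Sigma>"
    using face_in_fan[OF \<sigma> face_of_simplicial_cone[OF S, of "{s}"]] s convex_cone_hull_nonempty
    by blast
  moreover have "dim (convex_cone hull {s}) = 1"
  proof -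
    have "span (convex_cone hull {s}) = span {s}"
    proof
      show "span (convex_cone hull {s}) \<subseteq> span {s}"
        by (intro span_minimal subspace_span) (auto simp: convex_cone_hull_singleton span_base span_scale)
    qed (simp add: span_mono hull_subset)
    then have "dim (convex_cone hull {s}) = dim {s}"
      by (metis dim_span)
    also have "\<dots> = 1"
      using S s dependent_zero by (subst dim_eq_card_independent) (auto intro: independent_mono)
    finally show ?thesis .
  qed
  ultimately have "convex_cone hull {s} \<in> range (\<lambda>i. convex_cone hull {a i})"
    using rays by (auto simp: ray_generators_def bij_betw_def)
  then obtain i where "convex_cone hull {s} = convex_cone hull {a i}" by blast
  moreover from this have "a i \<in> convex_cone hull S"
    using sub by (auto simp: hull_inc)
  ultimately show ?thesis by (rule that)
qed

lemma simplicial_cone_generators: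
  assumes "\<sigma> \<in> \<Sigma>"
  obtains S where "independent S" "\<sigma> = convex_cone hull S"
proof -
  obtain B S where "independent B" "S \<subseteq> B" "\<sigma> = convex_cone hull S"
    using bspec[OF conjunct2[OF simplicial[unfolded simplicial_fan_def]] assms] by metis
  then show ?thesis
    using that independent_mono by metis
qed

lemma cone_eq_hull_of_rays:
  assumes "\<sigma> \<in> \<Sigma>"
  shows "\<sigma> = convex_cone hull (a ` {i. a i \<in> \<sigma>})"
proof -
  obtain S where S: "independent S" "\<sigma> = convex_cone hull S"
    using simplicial_cone_generators[OF assms] .
  have "s \<in> convex_cone hull (a ` {i. a i \<in> \<sigma>})" if s: "s \<in> S" for s
  proof -
    obtain i where i: "convex_cone hull {s} = convex_cone hull {a i}" "a i \<in> \<sigma>"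
      using simplicial_generator_ray[OF S(1) assms[unfolded S(2)] s] S(2) by metis
    have "s \<in> convex_cone hull {a i}"
      unfolding i(1)[symmetric] by (simp add: hull_inc)
    moreover have "convex_cone hull {a i} \<subseteq> convex_cone hull (a ` {i. a i \<in> \<sigma>})"
      using i(2) by (intro hull_mono) auto
    ultimately show ?thesis by blast
  qed
  then have "convex_cone hull S \<subseteq> convex_cone hull (a ` {i. a i \<in> \<sigma>})"
    by (intro hull_minimal) (auto simp: convex_cone_convex_cone_hull)
  moreover have "convex_cone hull (a ` {i. a i \<in> \<sigma>}) \<subseteq> \<sigma>"
    by (rule hull_minimal) (auto simp: S(2) convex_cone_convex_cone_hull)
  ultimately show ?thesis
    using S(2) by simp
qed

text \<open>Rescaled, the \<open>a\<^sub>i\<close> with \<open>i \<in> I\<close> are linearly independent generators of the cone, so any part of them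
  spans a face.\<close>

lemma underlying_complex_down_closed:
  assumes I: "I \<in> underlying_complex \<Sigma> a" and J: "J \<subseteq> I"
  shows "J \<in> underlying_complex \<Sigma> a"
proof -
  let ?\<sigma> = "convex_cone hull (a ` I)"
  have \<sigma>: "?\<sigma> \<in> \<Sigma>" using I by (simp add: underlying_complex_def)
  obtain S where S: "independent S" "?\<sigma> = convex_cone hull S"
    using simplicial_cone_generators[OF \<sigma>] .
  have fin: "finite S" using S independent_imp_finite by blast
  define T where "T = {s \<in> S. s \<in> convex_cone hull (a ` J)}"
  have "a j \<in> convex_cone hull T" if j: "j \<in> J" for j
  proof -
    have aj: "a j \<in> ?\<sigma>" using j J by (auto intro: hull_inc)
    obtain c where c: "\<forall>s\<in>S. 0 \<le> c s" "a j = (\<Sum>s\<in>S. c s *\<^sub>R s)"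
      using aj S(2) convex_cone_hull_finite[OF fin] by auto
    obtain s where s: "s \<in> S" "c s \<noteq> 0"
      using linear_combination_nonzero[of c id S] generator_nonzero[of j] c(2) by auto
    have face: "(convex_cone hull {a j}) face_of convex_cone hull (id ` S)"
      using ray_face_of_cone[OF \<sigma> aj] S(2) by simp
    have "id s \<in> convex_cone hull {a j}"
    proof (rule face_of_convex_cone_hull_generator[OF face fin, of c])
      show "(\<Sum>s\<in>S. c s *\<^sub>R id s) \<in> convex_cone hull {a j}"
        using c(2) by (simp add: hull_inc)
      show "0 < c s" using s c(1) by fastforce
    qed (use c s convex_cone_convex_cone_hull in auto)
    then obtain d where d: "0 \<le> d" "s = d *\<^sub>R a j"
      by (auto simp: convex_cone_hull_singleton)
    have "s \<noteq> 0" using S(1) s(1) dependent_zero by blast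
    then have "a j = (1 / d) *\<^sub>R s" "0 < d" using d by auto
    moreover have "s \<in> T"
      using s(1) d j by (auto simp: T_def intro!: convex_cone_hull_mul[OF hull_inc])
    ultimately show ?thesis
      by (auto intro!: convex_cone_hull_mul[OF hull_inc])
  qed
  then have "convex_cone hull (a ` J) \<subseteq> convex_cone hull T"
    by (intro hull_minimal) (auto simp: convex_cone_convex_cone_hull)
  moreover have "convex_cone hull T \<subseteq> convex_cone hull (a ` J)"
    by (intro hull_minimal) (auto simp: convex_cone_convex_cone_hull T_def)
  ultimately have "convex_cone hull (a ` J) = convex_cone hull T" by blast
  moreover have "convex_cone hull T face_of ?\<sigma>"
    unfolding S(2) by (rule face_of_simplicial_cone[OF S(1)]) (auto simp: T_def)
  ultimately show ?thesis
    using face_in_fan[OF \<sigma> _ convex_cone_hull_nonempty] by (simp add: underlying_complex_def)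
qed

lemma complete_representation:
  assumes "complete_fan \<Sigma>"
  shows "\<exists>y. (\<forall>i. 0 \<le> y $ i) \<and> {i. y $ i \<noteq> 0} \<in> underlying_complex \<Sigma> a \<and> Lambda_R a y = x"
proof -
  have "x \<in> \<Union>\<Sigma>" using assms by (simp add: complete_fan_def)
  then obtain \<sigma> where \<sigma>: "\<sigma> \<in> \<Sigma>" "x \<in> \<sigma>" by blast
  define I where "I = {i. a i \<in> \<sigma>}"
  have eq: "\<sigma> = convex_cone hull (a ` I)"
    unfolding I_def by (rule cone_eq_hull_of_rays[OF \<sigma>(1)])
  then obtain c where c: "\<forall>i\<in>I. 0 \<le> c i" "x = (\<Sum>i\<in>I. c i *\<^sub>R a i)"
    using \<sigma>(2) convex_cone_hull_image[of I a] by auto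
  define y :: "real ^ 'm" where "y = (\<chi> i. if i \<in> I then c i else 0)"
  have "Lambda_R a y = (\<Sum>i\<in>I. c i *\<^sub>R a i)"
    unfolding Lambda_R_def by (rule sum.mono_neutral_cong_right) (auto simp: y_def)
  moreover have "I \<in> underlying_complex \<Sigma> a"
    using \<sigma>(1) eq by (simp add: underlying_complex_def)
  then have "{i. y $ i \<noteq> 0} \<in> underlying_complex \<Sigma> a"
    by (rule underlying_complex_down_closed) (auto simp: y_def)
  ultimately show ?thesis
    using c by (intro exI[of _ y]) (auto simp: y_def)
qed

end

section \<open>Rescaling, the space \<open>U(K)\<close> and the moment-angle complex\<close>

definition rescale :: "real ^ 'm \<Rightarrow> complex ^ 'm \<Rightarrow> complex ^ 'm" where
  "rescale u z = (\<chi> i. exp (u $ i) *\<^sub>R z $ i)"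

lemma rescale_nth [simp]: "rescale u z $ i = exp (u $ i) *\<^sub>R z $ i"
  by (simp add: rescale_def)

lemma rescale_0 [simp]: "rescale 0 z = z"
  by (simp add: vec_eq_iff)

lemma rescale_rescale [simp]: "rescale u (rescale v z) = rescale (u + v) z"
  by (simp add: vec_eq_iff exp_add)

lemma rescale_uminus_eq_iff: "rescale (- u) z = w \<longleftrightarrow> z = rescale u w"
  by (metis add.left_inverse add.right_inverse rescale_0 rescale_rescale)

lemma bounded_linear_rescale: "bounded_linear (rescale u)"
proof -
  have "linear (rescale u)"
    by (rule linearI) (simp_all add: vec_eq_iff scaleR_add_right)
  then show ?thesis by (simp add: linear_conv_bounded_linear)
qed

lemma continuous_on_rescale: "continuous_on S (rescale u)"
  by (rule linear_continuous_on[OF bounded_linear_rescale])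

lemma Lambda_R_linear:
  "Lambda_R a 0 = 0"
  "Lambda_R a (x + y) = Lambda_R a x + Lambda_R a y"
  "Lambda_R a (x - y) = Lambda_R a x - Lambda_R a y"
  "Lambda_R a (- x) = - Lambda_R a x"
  "Lambda_R a (r *\<^sub>R x) = r *\<^sub>R Lambda_R a x"
  by (simp_all add: Lambda_R_def scaleR_add_left scaleR_diff_left sum.distrib sum_subtractf
      sum_negf scaleR_sum_right)

lemma continuous_on_Lambda_R:
  fixes a :: "'m::finite \<Rightarrow> 'a::real_normed_vector"
  shows "continuous_on S (Lambda_R a)"
  unfolding Lambda_R_def by (intro continuous_intros)

lemma second_countable_euclidean: "second_countable (euclidean :: 'x::second_countable_topology topology)"
proof -
  obtain B :: "'x set set" where B: "countable B" "topological_basis B"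
    using ex_countable_basis by blast
  show ?thesis
    unfolding second_countable_def
  proof (intro exI[of _ B] conjI ballI allI impI B(1))
    show "openin euclidean V" if "V \<in> B" for V
      using topological_basis_open[OF B(2) that] by simp
    show "\<exists>V\<in>B. x \<in> V \<and> V \<subseteq> U" if "openin euclidean U \<and> x \<in> U" for U x
      using topological_basisE[OF B(2), of U x] that by (metis open_openin)
  qed
qed

lemma U_space_iff:
  assumes "\<And>I J. I \<in> K \<Longrightarrow> J \<subseteq> I \<Longrightarrow> J \<in> K"
  shows "z \<in> U_space K \<longleftrightarrow> {i. z $ i = 0} \<in> K"
proof
  assume "z \<in> U_space K"
  then obtain I where I: "I \<in> K" "\<forall>j. j \<notin> I \<longrightarrow> z $ j \<noteq> 0"
    by (auto simp: U_space_def polyhedral_product_def)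
  then show "{i. z $ i = 0} \<in> K"
    using assms[OF I(1), of "{i. z $ i = 0}"] by auto
qed (auto simp: U_space_def polyhedral_product_def intro!: bexI[of _ "{i. z $ i = 0}"])

lemma open_U_space:
  fixes K :: "'m::finite set set"
  shows "open (U_space K)"
proof -
  have "open {x :: complex ^ 'm. \<forall>j. j \<notin> I \<longrightarrow> x $ j \<noteq> 0}" for I
  proof -
    have "{x :: complex ^ 'm. \<forall>j. j \<notin> I \<longrightarrow> x $ j \<noteq> 0} = (\<Inter>j\<in>-I. {x. x $ j \<noteq> 0})"
      by auto
    also have "open \<dots>"
      by (intro open_INT) (auto intro!: open_Collect_neq continuous_intros)
    finally show ?thesis .
  qed
  then show ?thesis
    by (auto simp: U_space_def polyhedral_product_def)
qed

text \<open>The smallest admissible \<open>I\<close> in the union that defines the polyhedral product is the set of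
  coordinates of absolute value different from one. The same principle gives the description of
  \<open>U(K)\<close> by zero sets above.\<close>

lemma moment_angle_complex_iff:
  assumes "\<And>I J. I \<in> K \<Longrightarrow> J \<subseteq> I \<Longrightarrow> J \<in> K"
  shows "z \<in> moment_angle_complex K \<longleftrightarrow> (\<forall>i. norm (z $ i) \<le> 1) \<and> {i. norm (z $ i) \<noteq> 1} \<in> K"
proof
  assume "z \<in> moment_angle_complex K"
  then obtain I where I: "I \<in> K" "\<forall>j. norm (z $ j) \<le> 1" "\<forall>j. j \<notin> I \<longrightarrow> norm (z $ j) = 1"
    by (auto simp: moment_angle_complex_def polyhedral_product_def)
  then show "(\<forall>i. norm (z $ i) \<le> 1) \<and> {i. norm (z $ i) \<noteq> 1} \<in> K"
    using assms[OF I(1), of "{i. norm (z $ i) \<noteq> 1}"] by auto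
qed (auto simp: moment_angle_complex_def polyhedral_product_def
    intro!: bexI[of _ "{i. norm (z $ i) \<noteq> 1}"])

lemma compact_moment_angle_complex:
  fixes K :: "'m::finite set set"
  shows "compact (moment_angle_complex K)"
proof -
  have "closed {x :: complex ^ 'm. (\<forall>j. x $ j \<in> cball 0 1) \<and> (\<forall>j. j \<notin> I \<longrightarrow> x $ j \<in> sphere 0 1)}" for I
  proof -
    have "{x :: complex ^ 'm. (\<forall>j. x $ j \<in> cball 0 1) \<and> (\<forall>j. j \<notin> I \<longrightarrow> x $ j \<in> sphere 0 1)}
        = (\<Inter>j. {x. norm (x $ j) \<le> 1}) \<inter> (\<Inter>j\<in>-I. {x. norm (x $ j) = 1})"
      by auto
    also have "closed \<dots>"
      by (intro closed_Int closed_INT) (auto intro!: closed_Collect_le closed_Collect_eq continuous_intros)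
    finally show ?thesis .
  qed
  then have "closed (moment_angle_complex K)"
    unfolding moment_angle_complex_def polyhedral_product_def by (intro closed_UN) auto
  moreover have "moment_angle_complex K \<subseteq> cball 0 (\<Sum>i\<in>(UNIV :: 'm set). 1)"
  proof
    fix z :: "complex ^ 'm" assume "z \<in> moment_angle_complex K"
    then have "norm (z $ i) \<le> 1" for i
      by (auto simp: moment_angle_complex_def polyhedral_product_def)
    then have "(\<Sum>i\<in>UNIV. norm (z $ i)) \<le> (\<Sum>i\<in>(UNIV :: 'm set). 1)"
      by (intro sum_mono) auto
    moreover have "norm z \<le> (\<Sum>i\<in>UNIV. norm (z $ i))"
      unfolding norm_vec_def by (rule L2_set_le_sum) auto
    ultimately show "z \<in> cball 0 (\<Sum>i\<in>(UNIV :: 'm set). 1)" by simp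
  qed
  ultimately show ?thesis
    using bounded_subset[OF bounded_cball] compact_eq_bounded_closed by blast
qed

section \<open>The action: freeness and properness\<close>

text \<open>What the rest of the argument needs to know about a complete simplicial fan: \<open>K\<close> is a simplicial
  complex, and every vector is a nonnegative combination of the \<open>a\<^sub>i\<close> with support in \<open>K\<close>, in only one
  way. Uniqueness is phrased for the difference \<open>u\<close> of two such combinations.\<close>

locale fan_coordinates =
  fixes a :: "'m::finite \<Rightarrow> 'v::euclidean_space" and K :: "'m set set"
  assumes down_closed: "\<And>I J. I \<in> K \<Longrightarrow> J \<subseteq> I \<Longrightarrow> J \<in> K"
    and kernel_trivial: "\<And>u. Lambda_R a u = 0 \<Longrightarrow> {i. 0 < u $ i} \<in> K \<Longrightarrow> {i. u $ i < 0} \<in> K \<Longrightarrow> u = 0"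
    and representation: "\<And>x. \<exists>y. (\<forall>i. 0 \<le> y $ i) \<and> {i. y $ i \<noteq> 0} \<in> K \<and> Lambda_R a y = x"
begin

lemma U_iff: "z \<in> U_space K \<longleftrightarrow> {i. z $ i = 0} \<in> K"
  by (rule U_space_iff) (rule down_closed)

lemma Z_iff:
  "z \<in> moment_angle_complex K \<longleftrightarrow> (\<forall>i. norm (z $ i) \<le> 1) \<and> {i. norm (z $ i) \<noteq> 1} \<in> K"
  by (rule moment_angle_complex_iff) (rule down_closed)

lemma kernel_trivial_supported:
  assumes "Lambda_R a u = 0" "I \<in> K" "\<And>i. i \<notin> I \<Longrightarrow> u $ i = 0"
  shows "u = 0"
proof (rule kernel_trivial[OF assms(1)])
  show "{i. 0 < u $ i} \<in> K" "{i. u $ i < 0} \<in> K"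
    using assms(3) by (intro down_closed[OF assms(2)] subsetI; force)+
qed

lemma rescale_in_U [simp]: "rescale u z \<in> U_space K \<longleftrightarrow> z \<in> U_space K"
  by (simp add: U_iff)

lemma carrier_R_group: "carrier (R_group a) = (\<lambda>u. \<chi> i. exp (u $ i)) ` {u. Lambda_R a u = 0}"
  by (simp add: R_group_def)

lemma carrierE:
  assumes "g \<in> carrier (R_group a)"
  obtains u where "Lambda_R a u = 0" "g = (\<chi> i. exp (u $ i))"
  using assms unfolding carrier_R_group by (elim imageE CollectE)

lemma exp_in_carrier: "Lambda_R a u = 0 \<Longrightarrow> (\<chi> i. exp (u $ i)) \<in> carrier (R_group a)"
  unfolding carrier_R_group by (rule imageI) simp

text \<open>All computations are carried out additively, with kernel vectors \<open>u\<close> in place of the group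
  elements \<open>exp u\<close>.\<close>

lemma R_action_exp:
  "z \<in> U_space K \<Longrightarrow> R_action K (\<chi> i. exp (u $ i)) z = rescale u z"
  by (simp add: R_action_def vec_eq_iff scaleR_conv_of_real)

lemma orbit_eq:
  "z \<in> U_space K \<Longrightarrow> orbit (R_group a) (R_action K) z = {rescale u z | u. Lambda_R a u = 0}"
  unfolding orbit_def
  by (auto elim!: carrierE simp: R_action_exp) (metis exp_in_carrier R_action_exp)

lemma group_R_group: "group (R_group a)"
proof (rule groupI)
  fix x assume "x \<in> carrier (R_group a)"
  then obtain u where u: "x = (\<chi> i. exp (u $ i))" "Lambda_R a u = 0"
    by (auto simp: carrier_R_group)
  then show "\<exists>y\<in>carrier (R_group a). y \<otimes>\<^bsub>R_group a\<^esub> x = \<one>\<^bsub>R_group a\<^esub>"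
    unfolding carrier_R_group
    by (intro bexI[of _ "\<chi> i. exp ((- u) $ i)"] imageI)
       (auto simp: R_group_def vec_eq_iff Lambda_R_linear exp_minus)
next
  fix x y assume "x \<in> carrier (R_group a)" "y \<in> carrier (R_group a)"
  then obtain u v where "x = (\<chi> i. exp (u $ i))" "Lambda_R a u = 0"
    "y = (\<chi> i. exp (v $ i))" "Lambda_R a v = 0"
    by (auto simp: carrier_R_group)
  then show "x \<otimes>\<^bsub>R_group a\<^esub> y \<in> carrier (R_group a)"
    unfolding carrier_R_group
    by (intro image_eqI[of _ _ "u + v"]) (auto simp: R_group_def vec_eq_iff exp_add Lambda_R_linear)
next
  show "\<one>\<^bsub>R_group a\<^esub> \<in> carrier (R_group a)"
    unfolding carrier_R_group
    by (intro image_eqI[of _ _ 0]) (auto simp: R_group_def vec_eq_iff Lambda_R_linear)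
qed (auto simp: R_group_def mult.assoc)

lemma group_action_R: "group_action (R_group a) (U_space K) (R_action K)"
proof -
  have Bij: "R_action K x \<in> Bij (U_space K)" if x: "x \<in> carrier (R_group a)" for x
  proof -
    obtain u where u: "x = (\<chi> i. exp (u $ i))"
      using x by (rule carrierE)
    have "bij_betw (R_action K x) (U_space K) (U_space K)"
      by (rule bij_betw_byWitness[where f' = "rescale (- u)"])
         (auto simp: u R_action_exp)
    then show ?thesis
      by (simp add: Bij_def R_action_def)
  qed
  have "R_action K \<in> hom (R_group a) (BijGroup (U_space K))"
  proof (rule homI)
    fix x y assume xy: "x \<in> carrier (R_group a)" "y \<in> carrier (R_group a)"
    then obtain u v where u: "x = (\<chi> i. exp (u $ i))" "y = (\<chi> i. exp (v $ i))"
      by (auto simp: carrier_R_group)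
    have xy_eq: "x * y = (\<chi> i. exp ((u + v) $ i))"
      by (simp add: u vec_eq_iff exp_add)
    have "R_action K (x * y) z = compose (U_space K) (R_action K x) (R_action K y) z" for z
    proof (cases "z \<in> U_space K")
      case True
      then show ?thesis
        by (subst xy_eq, subst R_action_exp) (simp_all add: compose_eq u R_action_exp)
    next
      case False
      then show ?thesis by (simp add: R_action_def compose_def)
    qed
    then show "R_action K (x \<otimes>\<^bsub>R_group a\<^esub> y) =
        R_action K x \<otimes>\<^bsub>BijGroup (U_space K)\<^esub> R_action K y"
      using Bij xy by (auto simp: BijGroup_def R_group_def)
  qed (use Bij in \<open>simp add: BijGroup_def\<close>)
  then show ?thesis
    by (intro group_action.intro group_hom.intro group_hom_axioms.intro group_R_group group_BijGroup)
qed

lemma free_R: "free_action (R_group a) (U_space K) (R_action K)"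
  unfolding free_action_def
proof (intro conjI ballI group_action_R)
  fix z assume z: "z \<in> U_space K"
  have trivial: "u = 0" if "Lambda_R a u = 0" "rescale u z = z" for u
  proof (rule kernel_trivial_supported[OF that(1)])
    show "{i. z $ i = 0} \<in> K" using z by (simp add: U_iff)
    show "u $ i = 0" if "i \<notin> {i. z $ i = 0}" for i
    proof -
      have "exp (u $ i) *\<^sub>R z $ i = z $ i"
        using \<open>rescale u z = z\<close> by (metis rescale_nth)
      then show ?thesis using that by (simp add: scaleR_conv_of_real)
    qed
  qed
  have one: "\<one>\<^bsub>R_group a\<^esub> = (\<chi> i. exp ((0 :: real ^ 'm) $ i))"
    by (simp add: R_group_def vec_eq_iff)
  show "stabilizer (R_group a) (R_action K) z = {\<one>\<^bsub>R_group a\<^esub>}"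
  proof (intro subset_antisym subsetI)
    fix g assume "g \<in> stabilizer (R_group a) (R_action K) z"
    then have "g \<in> carrier (R_group a)" and gz: "R_action K g z = z"
      by (simp_all add: stabilizer_def)
    then obtain u where "Lambda_R a u = 0" "g = (\<chi> i. exp (u $ i))"
      using carrierE by blast
    then show "g \<in> {\<one>\<^bsub>R_group a\<^esub>}"
      using trivial[of u] gz by (simp add: R_action_exp z one)
  next
    fix g assume "g \<in> {\<one>\<^bsub>R_group a\<^esub>}"
    then have "g = (\<chi> i. exp ((0 :: real ^ 'm) $ i))" by (simp only: one singleton_iff)
    then show "g \<in> stabilizer (R_group a) (R_action K) z"
      using exp_in_carrier[of 0] R_action_exp[OF z, of 0] by (simp add: stabilizer_def Lambda_R_linear)
  qed
qed

text \<open>The heart of properness. If \<open>u\<^sub>k\<close> were unbounded, a limit direction \<open>v\<close> would be a nonzero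
  element of the kernel. Where \<open>v\<close> is positive the scaling factors explode, which forces the limit
  of the sources to vanish; where it is negative the limit of the targets vanishes. Both vanishing
  sets belong to \<open>K\<close>, so \<open>v = 0\<close>.\<close>

lemma kernel_sequence_bounded:
  assumes u: "\<And>k::nat. Lambda_R a (u k) = 0"
    and z: "z \<longlonglongrightarrow> z0" "z0 \<in> U_space K"
    and w: "(\<lambda>k. rescale (u k) (z k)) \<longlonglongrightarrow> w0" "w0 \<in> U_space K"
  shows "bounded (range u)"
proof (rule ccontr)
  assume "\<not> bounded (range u)"
  obtain s where s: "strict_mono s" "\<And>n. real n < norm (u (s n))"
  proof -
    have "\<exists>k>m. real n < norm (u k)" for m n
    proof (rule ccontr)
      assume "\<not> (\<exists>k>m. real n < norm (u k))"
      then have "norm (u k) \<le> max (real n) (Max ((\<lambda>k. norm (u k)) ` {..m}))" for k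
        by (cases "k \<le> m") (auto simp: le_max_iff_disj not_le)
      then show False
        using \<open>\<not> bounded (range u)\<close> by (auto simp: bounded_iff)
    qed
    then obtain f where f: "\<And>m n. f m n > m" "\<And>m n. real n < norm (u (f m n))"
      by metis
    \<comment> \<open>Choose each index beyond the previous one.\<close>
    define s where "s = rec_nat (f 0 0) (\<lambda>n m. f m (Suc n))"
    have "strict_mono s"
      by (rule strict_monoI_Suc) (simp add: s_def f)
    moreover have "real n < norm (u (s n))" for n
      by (cases n) (use f(2)[of 0 0] in \<open>simp_all add: s_def f del: of_nat_Suc\<close>)
    ultimately show ?thesis by (rule that)
  qed
  define t where "t n = norm (u (s n))" for n
  have t_pos: "0 < t n" for n
    using s(2)[of n] by (simp add: t_def) (metis less_le_trans not_less of_nat_0_le_iff norm_eq_zero less_irrefl)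
  have t_top: "filterlim t at_top sequentially"
    by (rule filterlim_at_top_mono[OF filterlim_real_sequentially])
       (auto simp: t_def intro!: always_eventually less_imp_le[OF s(2)])
  define v where "v n = (1 / t n) *\<^sub>R u (s n)" for n
  have u_v: "u (s n) $ i = t n * v n $ i" for n i
    using t_pos[of n] by (simp add: v_def)
  have "v n \<in> sphere 0 1" for n
    using t_pos[of n] by (simp add: v_def t_def)
  then obtain v0 r where v0: "v0 \<in> sphere 0 1" and r: "strict_mono r" and lim: "(v \<circ> r) \<longlonglongrightarrow> v0"
    using compact_sphere[unfolded compact_def, rule_format, of v 0 1] by blast
  have t_r: "filterlim (\<lambda>n. t (r n)) at_top sequentially"
    by (rule filterlim_compose[OF t_top filterlim_subseq[OF r]])
  have v_i: "(\<lambda>n. v (r n) $ i) \<longlonglongrightarrow> v0 $ i" for i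
    using tendsto_vec_nth[OF lim, of i] by (simp add: o_def)
  have sr: "strict_mono (\<lambda>n. s (r n))"
    using s(1) r by (simp add: strict_mono_def)
  have z_i: "(\<lambda>n. norm (z (s (r n)) $ i)) \<longlonglongrightarrow> norm (z0 $ i)" for i
    using LIMSEQ_subseq_LIMSEQ[OF z(1) sr]
    by (intro tendsto_norm tendsto_vec_nth) (simp add: o_def)
  have w_i: "(\<lambda>n. exp (u (s (r n)) $ i) * norm (z (s (r n)) $ i)) \<longlonglongrightarrow> norm (w0 $ i)" for i
    using tendsto_norm[OF tendsto_vec_nth[OF LIMSEQ_subseq_LIMSEQ[OF w(1) sr], of i]]
    by (simp add: o_def)
  have "Lambda_R a v0 = 0"
  proof -
    have "(\<lambda>n. Lambda_R a ((v \<circ> r) n)) \<longlonglongrightarrow> Lambda_R a v0"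
      using continuous_on_tendsto_compose[OF continuous_on_Lambda_R[of UNIV a] lim] by simp
    moreover have "Lambda_R a ((v \<circ> r) n) = 0" for n
      by (simp add: v_def Lambda_R_linear u)
    ultimately show ?thesis by (simp add: LIMSEQ_const_iff)
  qed
  moreover have "z0 $ i = 0" if "0 < v0 $ i" for i
  proof -
    have "filterlim (\<lambda>n. v (r n) $ i * t (r n)) at_top sequentially"
      by (rule filterlim_tendsto_pos_mult_at_top[OF v_i that t_r])
    then have "filterlim (\<lambda>n. - (u (s (r n)) $ i)) at_bot sequentially"
      by (simp add: filterlim_uminus_at_bot u_v mult.commute)
    then have "(\<lambda>n. exp (- (u (s (r n)) $ i))) \<longlonglongrightarrow> 0"
      by (rule filterlim_compose[OF exp_at_bot])
    then have "(\<lambda>n. exp (- (u (s (r n)) $ i)) * (exp (u (s (r n)) $ i) * norm (z (s (r n)) $ i)))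
        \<longlonglongrightarrow> 0 * norm (w0 $ i)"
      by (intro tendsto_mult w_i)
    then have "(\<lambda>n. norm (z (s (r n)) $ i)) \<longlonglongrightarrow> 0"
      by (simp add: exp_minus field_simps)
    then show ?thesis
      using LIMSEQ_unique[OF z_i] by fastforce
  qed
  then have "{i. 0 < v0 $ i} \<in> K"
    using z(2) by - (rule down_closed[of "{i. z0 $ i = 0}"]; auto simp: U_iff)
  moreover have "w0 $ i = 0" if "v0 $ i < 0" for i
  proof -
    have "filterlim (\<lambda>n. v (r n) $ i * t (r n)) at_bot sequentially"
      by (rule filterlim_tendsto_neg_mult_at_bot[OF v_i that t_r])
    then have "(\<lambda>n. exp (u (s (r n)) $ i)) \<longlonglongrightarrow> 0"
      by (intro filterlim_compose[OF exp_at_bot]) (simp add: u_v mult.commute)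
    then have "(\<lambda>n. exp (u (s (r n)) $ i) * norm (z (s (r n)) $ i)) \<longlonglongrightarrow> 0 * norm (z0 $ i)"
      by (intro tendsto_mult z_i)
    then show ?thesis
      using LIMSEQ_unique[OF w_i] by fastforce
  qed
  then have "{i. v0 $ i < 0} \<in> K"
    using w(2) by - (rule down_closed[of "{i. w0 $ i = 0}"]; auto simp: U_iff)
  ultimately have "v0 = 0"
    by (rule kernel_trivial)
  then show False using v0 by simp
qed

lemma proper_R:
  "proper_action (top_of_set (carrier (R_group a))) (R_group a) (top_of_set (U_space K)) (R_action K)"
proof -
  let ?C = "carrier (R_group a)" and ?U = "U_space K"
  let ?f = "\<lambda>(g, x). (R_action K g x, x)"
  have fU: "?f ` (?C \<times> ?U) \<subseteq> ?U \<times> ?U"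
    by (auto simp: carrier_R_group R_action_exp)
  have cont: "continuous_on (?C \<times> ?U) ?f"
  proof -
    have "continuous_on (?C \<times> ?U) (\<lambda>p. (\<chi> i. of_real (fst p $ i) * snd p $ i, snd p))"
      by (intro continuous_intros)
    then show ?thesis
      by (rule continuous_on_eq) (auto simp: R_action_def)
  qed
  have comp: "compact (?C \<times> ?U \<inter> ?f -` V)" if V: "V \<subseteq> ?U \<times> ?U" "compact V" for V
    unfolding compact_def
  proof (intro allI impI)
    fix p :: "nat \<Rightarrow> _" assume p: "\<forall>n. p n \<in> ?C \<times> ?U \<inter> ?f -` V"
    define z where "z n = snd (p n)" for n
    have pC: "fst (p n) \<in> ?C" and zU: "z n \<in> ?U" and pV: "?f (p n) \<in> V" for n
      using p[rule_format, of n] unfolding z_def Int_iff mem_Times_iff vimage_eq by simp_all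
    have "\<exists>u. Lambda_R a u = 0 \<and> fst (p n) = (\<chi> i. exp (u $ i))" for n
      using pC[of n] by (rule carrierE) blast
    then obtain u where u: "\<And>n. Lambda_R a (u n) = 0" "\<And>n. fst (p n) = (\<chi> i. exp (u n $ i))"
      by metis
    have p_eq: "p n = ((\<chi> i. exp (u n $ i)), z n)" for n
      using u(2)[of n] by (simp add: z_def prod_eq_iff)
    have fp: "?f (p n) = (rescale (u n) (z n), z n)" for n
      using zU[of n] by (simp add: p_eq R_action_exp)
    have "(rescale (u n) (z n), z n) \<in> V" for n
      using pV[of n] unfolding fp .
    then obtain l r where l: "l \<in> V" and r: "strict_mono r"
      and lim: "((\<lambda>n. (rescale (u n) (z n), z n)) \<circ> r) \<longlonglongrightarrow> l"
      using V(2)[unfolded compact_def, rule_format, of "\<lambda>n. (rescale (u n) (z n), z n)"] by blast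
    have lims: "(\<lambda>n. rescale ((u \<circ> r) n) ((z \<circ> r) n)) \<longlonglongrightarrow> fst l" "(z \<circ> r) \<longlonglongrightarrow> snd l"
      using tendsto_fst[OF lim] tendsto_snd[OF lim] by (simp_all add: o_def)
    have lU: "fst l \<in> ?U" "snd l \<in> ?U" using l V(1) by auto
    have "bounded (range (u \<circ> r))"
      by (rule kernel_sequence_bounded[OF _ lims(2) lU(2) lims(1) lU(1)]) (simp add: u)
    then obtain u0 r' where r': "strict_mono r'" and u0: "((u \<circ> r) \<circ> r') \<longlonglongrightarrow> u0"
      using bounded_imp_convergent_subsequence by blast
    have "Lambda_R a u0 = 0"
    proof -
      have "(\<lambda>n. Lambda_R a (((u \<circ> r) \<circ> r') n)) \<longlonglongrightarrow> Lambda_R a u0"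
        using continuous_on_tendsto_compose[OF continuous_on_Lambda_R[of UNIV a] u0] by simp
      then show ?thesis by (simp add: u LIMSEQ_const_iff)
    qed
    then have C0: "(\<chi> i. exp (u0 $ i)) \<in> ?C"
      by (auto simp: carrier_R_group)
    have z_lim: "(\<lambda>n. z (r (r' n))) \<longlonglongrightarrow> snd l"
      using LIMSEQ_subseq_LIMSEQ[OF lims(2) r'] by (simp add: o_def)
    have u_lim: "(\<lambda>n. u (r (r' n))) \<longlonglongrightarrow> u0"
      using u0 by (simp add: o_def)
    have "(\<lambda>n. p (r (r' n))) \<longlonglongrightarrow> ((\<chi> i. exp (u0 $ i)), snd l)"
      unfolding p_eq by (intro tendsto_Pair z_lim vec_tendstoI) (auto intro!: tendsto_intros u_lim)
    then have p_lim: "(p \<circ> (r \<circ> r')) \<longlonglongrightarrow> ((\<chi> i. exp (u0 $ i)), snd l)"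
      by (simp add: o_def)
    have "(\<lambda>n. ?f ((p \<circ> (r \<circ> r')) n)) \<longlonglongrightarrow> ?f ((\<chi> i. exp (u0 $ i)), snd l)"
      by (rule continuous_on_tendsto_compose[OF cont p_lim]) (use C0 lU p in auto)
    moreover have "(\<lambda>n. ?f ((p \<circ> (r \<circ> r')) n)) \<longlonglongrightarrow> l"
      using LIMSEQ_subseq_LIMSEQ[OF lim r'] by (simp only: fp o_def)
    ultimately have "?f ((\<chi> i. exp (u0 $ i)), snd l) = l"
      by (rule LIMSEQ_unique)
    then have "((\<chi> i. exp (u0 $ i)), snd l) \<in> ?C \<times> ?U \<inter> ?f -` V"
      using C0 lU l by auto
    then show "\<exists>l\<in>?C \<times> ?U \<inter> ?f -` V. \<exists>r. strict_mono r \<and> (p \<circ> r) \<longlonglongrightarrow> l"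
      using p_lim strict_mono_o[OF r r'] by blast
  qed
  have "proper_map (top_of_set (?C \<times> ?U)) (top_of_set (?U \<times> ?U)) ?f"
    unfolding proper_map_def
  proof (intro conjI ballI)
    show "closed_map (top_of_set (?C \<times> ?U)) (top_of_set (?U \<times> ?U)) ?f"
      unfolding closed_map_def using proper_map[OF _ comp fU] by blast
    fix y assume "y \<in> topspace (top_of_set (?U \<times> ?U))"
    then have "compact (?C \<times> ?U \<inter> ?f -` {y})"
      by (intro comp) auto
    moreover have "{x \<in> topspace (top_of_set (?C \<times> ?U)). ?f x = y} = ?C \<times> ?U \<inter> ?f -` {y}"
      by auto
    ultimately show "compactin (top_of_set (?C \<times> ?U)) {x \<in> topspace (top_of_set (?C \<times> ?U)). ?f x = y}"
      by (simp add: compactin_subtopology)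
  qed
  then show ?thesis
    using cont fU group_action_R by (auto simp: proper_action_def)
qed

section \<open>The orbit space\<close>

abbreviation "q \<equiv> orbit (R_group a) (R_action K)"
abbreviation "orbits_top \<equiv> orbit_space (top_of_set (U_space K)) (R_group a) (R_action K)"

lemma orbit_eq_iff:
  assumes "z \<in> U_space K" "w \<in> U_space K"
  shows "q z = q w \<longleftrightarrow> (\<exists>u. Lambda_R a u = 0 \<and> w = rescale u z)"
proof
  assume "q z = q w"
  moreover have "w \<in> q w"
    unfolding orbit_eq[OF assms(2)] by (auto intro!: exI[of _ 0] simp: Lambda_R_linear)
  ultimately show "\<exists>u. Lambda_R a u = 0 \<and> w = rescale u z"
    using assms(1) by (auto simp: orbit_eq)
next
  assume "\<exists>u. Lambda_R a u = 0 \<and> w = rescale u z"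
  then obtain u where u: "Lambda_R a u = 0" "w = rescale u z" by blast
  have "\<exists>v'. rescale v w = rescale v' z \<and> Lambda_R a v' = 0" if "Lambda_R a v = 0" for v
    using that u by (intro exI[of _ "v + u"]) (simp add: Lambda_R_linear)
  moreover have "\<exists>v'. rescale v z = rescale v' w \<and> Lambda_R a v' = 0" if "Lambda_R a v = 0" for v
    using that u by (intro exI[of _ "v - u"]) (simp add: Lambda_R_linear)
  ultimately show "q z = q w"
    using assms by (auto simp: orbit_eq)
qed

lemma topspace_orbits: "topspace orbits_top = q ` U_space K"
  by (simp add: orbit_space_def topspace_quotient_topology)

lemma continuous_orbit: "continuous_map (top_of_set (U_space K)) orbits_top q"
  unfolding orbit_space_def by (rule quotient_imp_continuous_map[OF quotient_map_quotient_topology])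

text \<open>The saturation of an open set is a union of rescaled copies of it.\<close>

lemma openin_orbit_image:
  assumes "open W" "W \<subseteq> U_space K"
  shows "openin orbits_top (q ` W)"
proof -
  have "{x \<in> U_space K. q x \<in> q ` W} = (\<Union>u\<in>{u. Lambda_R a u = 0}. rescale u -` W)"
  proof (intro subset_antisym subsetI)
    fix x assume "x \<in> {x \<in> U_space K. q x \<in> q ` W}"
    then obtain w where w: "x \<in> U_space K" "w \<in> W" "q x = q w" by blast
    then obtain u where "Lambda_R a u = 0" "w = rescale u x"
      using orbit_eq_iff[of x w] assms(2) by blast
    then show "x \<in> (\<Union>u\<in>{u. Lambda_R a u = 0}. rescale u -` W)"
      using w(2) by blast
  next
    fix x assume "x \<in> (\<Union>u\<in>{u. Lambda_R a u = 0}. rescale u -` W)"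
    then obtain u where u: "Lambda_R a u = 0" "rescale u x \<in> W" by blast
    then have x: "rescale u x \<in> U_space K" "x \<in> U_space K"
      using assms(2) rescale_in_U by blast+
    then have "q x = q (rescale u x)"
      using orbit_eq_iff u(1) by blast
    then show "x \<in> {x \<in> U_space K. q x \<in> q ` W}"
      using x(2) u(2) by (simp add: rev_image_eqI)
  qed
  moreover have "open (rescale u -` W)" for u
    by (rule open_vimage[OF assms(1) continuous_on_rescale])
  ultimately have "open {x \<in> U_space K. q x \<in> q ` W}"
    by auto
  then show ?thesis
    using assms(2)
    by (auto simp: orbit_space_def openin_quotient_topology openin_open_eq[OF open_U_space])
qed

lemma open_map_orbit: "open_map (top_of_set (U_space K)) orbits_top q"
  by (auto simp: open_map_def openin_open_eq[OF open_U_space] intro: openin_orbit_image)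

text \<open>Properness makes the orbit relation closed, and a closed equivalence relation with open
  quotient map has a Hausdorff quotient.\<close>

lemma Hausdorff_orbits: "Hausdorff_space orbits_top"
  unfolding Hausdorff_space_def topspace_orbits
proof (intro allI impI)
  let ?C = "carrier (R_group a)" and ?U = "U_space K"
  let ?f = "\<lambda>(g, x). (R_action K g x, x)"
  fix X Y assume XY: "X \<in> q ` U_space K \<and> Y \<in> q ` U_space K \<and> X \<noteq> Y"
  then obtain x y where x: "x \<in> ?U" "X = q x" and y: "y \<in> ?U" "Y = q y" by blast
  let ?E = "{(w, z). w \<in> ?U \<and> z \<in> ?U \<and> q w = q z}"
  have E: "?f ` (?C \<times> ?U) = ?E"
  proof
    have "(R_action K g z, z) \<in> ?E" if g: "g \<in> ?C" and z: "z \<in> ?U" for g z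
    proof -
      obtain u where u: "Lambda_R a u = 0" "g = (\<chi> i. exp (u $ i))"
        using g by (rule carrierE)
      have "q z = q (rescale u z)"
        using u(1) z by (subst orbit_eq_iff) auto
      then show ?thesis
        using z by (simp add: u(2) R_action_exp)
    qed
    then show "?f ` (?C \<times> ?U) \<subseteq> ?E" by force
    show "?E \<subseteq> ?f ` (?C \<times> ?U)"
    proof (intro subsetI)
      fix e assume "e \<in> ?E"
      then obtain w z where e: "e = (w, z)" and w: "w \<in> ?U" and z: "z \<in> ?U" and wz: "q z = q w"
        by auto
      obtain u where u: "Lambda_R a u = 0" "w = rescale u z"
        using wz unfolding orbit_eq_iff[OF z w] by blast
      show "e \<in> ?f ` (?C \<times> ?U)"
        by (rule image_eqI[of _ _ "(\<chi> i. exp (u $ i), z)"])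
           (use u z in \<open>simp_all add: e exp_in_carrier R_action_exp\<close>)
    qed
  qed
  have closed: "closed_map (top_of_set (?C \<times> ?U)) (top_of_set (?U \<times> ?U)) ?f"
    using proper_R by (simp add: proper_action_def proper_map_def)
  have "closedin (top_of_set (?U \<times> ?U)) ?E"
    unfolding E[symmetric]
    by (rule closed[unfolded closed_map_def, rule_format, OF closedin_self])
  then have "openin (top_of_set (?U \<times> ?U)) (?U \<times> ?U - ?E)"
    by (simp add: closedin_def)
  then have op: "open (?U \<times> ?U - ?E)"
    by (simp add: openin_open_eq open_Times open_U_space)
  have "(x, y) \<in> ?U \<times> ?U - ?E" using x y XY by auto
  then obtain A B where AB: "open A" "open B" "(x, y) \<in> A \<times> B" "A \<times> B \<subseteq> ?U \<times> ?U - ?E"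
    by (rule open_prod_elim[OF op])
  then have sub: "A \<subseteq> ?U" "B \<subseteq> ?U" by auto
  have "q v \<noteq> q w" if "v \<in> A" "w \<in> B" for v w
    using subsetD[OF AB(4), of "(v, w)"] that sub by auto
  then have "disjnt (q ` A) (q ` B)"
    unfolding disjnt_iff by blast
  then show "\<exists>V W. openin orbits_top V \<and> openin orbits_top W \<and> X \<in> V \<and> Y \<in> W \<and> disjnt V W"
    using openin_orbit_image[OF AB(1) sub(1)] openin_orbit_image[OF AB(2) sub(2)] AB(3) x y
    by blast
qed

lemma second_countable_orbits: "second_countable orbits_top"
  by (rule second_countable_open_map_image[OF continuous_orbit open_map_orbit])
     (simp_all add: topspace_orbits second_countable_subtopology second_countable_euclidean)

section \<open>Orbits and the moment-angle complex\<close>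

lemma Z_subset_U: "moment_angle_complex K \<subseteq> U_space K"
proof
  fix z assume "z \<in> moment_angle_complex K"
  then have "{i. norm (z $ i) \<noteq> 1} \<in> K" by (simp add: Z_iff)
  then show "z \<in> U_space K"
    unfolding U_iff by (rule down_closed) auto
qed

text \<open>Where \<open>u\<close> is positive the point itself must have absolute value less than one, and where \<open>u\<close> is
  negative the rescaled point must; both supports therefore lie in sets belonging to \<open>K\<close>.\<close>

lemma Z_orbit_unique:
  assumes z: "z \<in> moment_angle_complex K" "rescale u z \<in> moment_angle_complex K"
    and u: "Lambda_R a u = 0"
  shows "u = 0"
proof (rule kernel_trivial[OF u])
  have "norm (z $ i) \<noteq> 1" if "0 < u $ i" for i
  proof
    assume "norm (z $ i) = 1"
    then have "exp (u $ i) \<le> 1"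
      using z(2) by (auto simp: Z_iff dest: spec[of _ i])
    then show False using that by simp
  qed
  then show "{i. 0 < u $ i} \<in> K"
    using z(1) by - (rule down_closed[of "{i. norm (z $ i) \<noteq> 1}"]; auto simp: Z_iff)
  have "norm (rescale u z $ i) \<noteq> 1" if "u $ i < 0" for i
  proof -
    have "exp (u $ i) * norm (z $ i) \<le> exp (u $ i) * 1"
      using z(1) by (intro mult_left_mono) (auto simp: Z_iff)
    also have "\<dots> < 1" using that by simp
    finally show ?thesis by simp
  qed
  then show "{i. u $ i < 0} \<in> K"
    using z(2) by - (rule down_closed[of "{i. norm (rescale u z $ i) \<noteq> 1}"]; auto simp: Z_iff)
qed

text \<open>For a point without zero coordinates, completeness of the fan, applied to the logarithms of the
  absolute values, provides the rescaling.\<close>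

lemma nonvanishing_orbit_meets_Z:
  assumes "\<And>i. z $ i \<noteq> 0"
  obtains u where "Lambda_R a u = 0" "rescale u z \<in> moment_angle_complex K"
proof -
  define y where "y = (\<chi> i. - ln (norm (z $ i)))"
  obtain x where x: "\<And>i. 0 \<le> x $ i" "{i. x $ i \<noteq> 0} \<in> K" "Lambda_R a x = Lambda_R a y"
    using representation by blast
  have n: "norm (rescale (y - x) z $ i) = exp (- (x $ i))" for i
    using assms[of i] by (simp add: y_def exp_diff exp_minus field_simps)
  show ?thesis
  proof (rule that)
    show "Lambda_R a (y - x) = 0" by (simp add: Lambda_R_linear x)
    show "rescale (y - x) z \<in> moment_angle_complex K"
      using x by (simp add: Z_iff n del: rescale_nth)
  qed
qed

text \<open>Surjectivity is a density argument, so the logarithmic picture is only needed for points without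
  zero coordinates.\<close>

lemma orbit_Z_surj: "q ` moment_angle_complex K = q ` U_space K"
proof
  show "q ` U_space K \<subseteq> q ` moment_angle_complex K"
  proof clarify
    fix z assume z: "z \<in> U_space K"
    \<comment> \<open>The orbits that meet the compact set form a closed set.\<close>
    have "compactin orbits_top (q ` moment_angle_complex K)"
      using compact_moment_angle_complex Z_subset_U
      by (intro image_compactin[OF _ continuous_orbit]) (simp add: compactin_subtopology)
    then have "closedin orbits_top (q ` moment_angle_complex K)"
      by (rule compactin_imp_closedin[OF Hausdorff_orbits])
    then have "closedin (top_of_set (U_space K)) {x \<in> U_space K. q x \<in> q ` moment_angle_complex K}"
      using closedin_continuous_map_preimage[OF continuous_orbit] by fastforce
    then obtain T where T: "closed T" "{x \<in> U_space K. q x \<in> q ` moment_angle_complex K} = U_space K \<inter> T"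
      by (auto simp: closedin_closed)
    \<comment> \<open>It contains the points without zero coordinates, which are dense.\<close>
    define p :: "nat \<Rightarrow> complex ^ 'm"
      where "p n = (\<chi> i. if z $ i = 0 then of_real (1 / real (Suc n)) else z $ i)" for n
    have "p n \<in> T" for n
    proof -
      have nz: "p n $ i \<noteq> 0" for i
        by (simp add: p_def del: of_nat_Suc)
      then obtain u where u: "Lambda_R a u = 0" "rescale u (p n) \<in> moment_angle_complex K"
        using nonvanishing_orbit_meets_Z by blast
      then have "p n \<in> U_space K"
        using Z_subset_U rescale_in_U by blast
      moreover from this have "q (p n) = q (rescale u (p n))"
        using u by (subst orbit_eq_iff) auto
      ultimately show ?thesis using T(2) u(2) by blast
    qed
    moreover have "p \<longlonglongrightarrow> z"
    proof (rule vec_tendstoI)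
      fix i
      have "(\<lambda>n. of_real (1 / real (Suc n))) \<longlonglongrightarrow> (of_real 0 :: complex)"
        using lim_inverse_n'[THEN LIMSEQ_Suc] by (intro tendsto_of_real) simp
      then show "(\<lambda>n. p n $ i) \<longlonglongrightarrow> z $ i"
        by (cases "z $ i = 0") (simp_all add: p_def del: of_nat_Suc)
    qed
    ultimately have "z \<in> T"
      using T(1) closed_sequentially by blast
    then show "q z \<in> q ` moment_angle_complex K"
      using T(2) z by blast
  qed
qed (use Z_subset_U in auto)

lemma orbit_Z_homeomorphic:
  "homeomorphic_map (top_of_set (moment_angle_complex K)) orbits_top q"
proof (rule bijective_closed_imp_homeomorphic_map)
  show cont: "continuous_map (top_of_set (moment_angle_complex K)) orbits_top q"
    using continuous_map_from_subtopology_mono[OF continuous_orbit Z_subset_U] .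
  show "closed_map (top_of_set (moment_angle_complex K)) orbits_top q"
    by (rule continuous_imp_closed_map[OF cont _ Hausdorff_orbits])
       (simp add: compact_space_subtopology compact_moment_angle_complex)
  show "q ` topspace (top_of_set (moment_angle_complex K)) = topspace orbits_top"
    by (simp add: topspace_orbits orbit_Z_surj)
  show "inj_on q (topspace (top_of_set (moment_angle_complex K)))"
  proof (rule inj_onI)
    fix z w assume "z \<in> topspace (top_of_set (moment_angle_complex K))"
      "w \<in> topspace (top_of_set (moment_angle_complex K))" and qzw: "q z = q w"
    then have zw: "z \<in> moment_angle_complex K" "w \<in> moment_angle_complex K"
      by simp_all
    then obtain u where "Lambda_R a u = 0" "w = rescale u z"
      using qzw orbit_eq_iff[of z w] Z_subset_U by blast
    then show "z = w"
      using Z_orbit_unique[of z u] zw by simp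
  qed
qed

lemma torus_times_rescale: "t * rescale u z = rescale u (t * z)"
  by (simp add: vec_eq_iff scaleR_conv_of_real)

lemma orbit_space_homeomorphic_Z:
  obtains h where "homeomorphic_map orbits_top (top_of_set (moment_angle_complex K)) h"
    "\<And>t z. t \<in> torus \<Longrightarrow> z \<in> U_space K \<Longrightarrow> h (q (t * z)) = t * h (q z)"
proof -
  obtain h where "homeomorphic_maps (top_of_set (moment_angle_complex K)) orbits_top q h"
    using orbit_Z_homeomorphic homeomorphic_map_maps by blast
  then have h: "homeomorphic_map orbits_top (top_of_set (moment_angle_complex K)) h"
    "\<And>p. p \<in> moment_angle_complex K \<Longrightarrow> h (q p) = p"
    by (auto simp: homeomorphic_maps_map)
  have "h (q (t * z)) = t * h (q z)" if t: "t \<in> torus" and z: "z \<in> U_space K" for t z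
  proof -
    have "q z \<in> q ` moment_angle_complex K"
      using orbit_Z_surj z by blast
    then obtain p where p: "p \<in> moment_angle_complex K" "q z = q p" by blast
    then obtain u where u: "Lambda_R a u = 0" "p = rescale u z"
      using orbit_eq_iff[OF z] Z_subset_U by blast
    have norm_t: "norm (t $ i) = 1" for i using t by (simp add: torus_def)
    then have "t $ i \<noteq> 0" for i by (metis norm_zero zero_neq_one)
    then have tz: "t * z \<in> U_space K" using z by (simp add: U_iff)
    have tp: "t * p \<in> moment_angle_complex K"
      using p(1) by (simp add: Z_iff norm_mult norm_t)
    have "q (t * z) = q (t * p)"
      using orbit_eq_iff[OF tz] tp Z_subset_U u torus_times_rescale by blast
    then show ?thesis using h(2) p tp by simp
  qed
  with h(1) show ?thesis by (rule that)
qed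

end

section \<open>Charts and transport of manifold structures\<close>

lemma chart_inj: "chart X V \<phi> \<Longrightarrow> inj_on \<phi> V"
  unfolding chart_def homeomorphic_eq_everything_map
  by (metis inf.absorb2 openin_subset topspace_subtopology)

lemma chart_open_image:
  assumes \<phi>: "chart X V \<phi>" and W: "openin X W"
  shows "open (\<phi> ` (V \<inter> W))"
proof -
  have "open_map (subtopology X V) (top_of_set (\<phi> ` V)) \<phi>"
    using \<phi> unfolding chart_def by (blast intro: homeomorphic_imp_open_map)
  moreover have "openin (subtopology X V) (V \<inter> W)"
    using W by (simp add: openin_subtopology_Int2)
  ultimately have "openin (top_of_set (\<phi> ` V)) (\<phi> ` (V \<inter> W))"
    by (simp add: open_map_def)
  then show ?thesis
    using \<phi> openin_open_eq unfolding chart_def by blast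
qed

text \<open>This turns the smooth structure of the orbit space into one of the moment-angle complex.\<close>

lemma smooth_manifold_transport:
  fixes A :: "('x set \<times> ('x \<Rightarrow> 'e::euclidean_space)) set"
  assumes h: "homeomorphic_map X Y h" and A: "smooth_manifold X A"
  shows "\<exists>B :: ('y set \<times> ('y \<Rightarrow> 'e)) set. smooth_manifold Y B"
proof -
  obtain k where "homeomorphic_maps X Y h k"
    using h homeomorphic_map_maps by blast
  then have k: "homeomorphic_map Y X k" and kh: "\<And>x. x \<in> topspace X \<Longrightarrow> k (h x) = x"
    by (auto simp: homeomorphic_maps_map)
  have space: "X homeomorphic_space Y"
    using h homeomorphic_map_imp_homeomorphic_space by blast
  have h_im: "h ` topspace X = topspace Y"
    using h by (rule homeomorphic_imp_surjective_map)
  have charts: "chart X V \<phi>" if "(V, \<phi>) \<in> A" for V \<phi>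
    using A that unfolding smooth_manifold_def smooth_atlas_def by blast
  have transitions: "\<forall>(V, \<phi>)\<in>A. \<forall>(W, \<psi>)\<in>A. smooth_on (\<psi> \<circ> inv_into V \<phi>) (\<phi> ` (V \<inter> W))"
    using A by (simp add: smooth_manifold_def smooth_atlas_def)
  have sub: "V \<subseteq> topspace X" if "(V, \<phi>) \<in> A" for V \<phi>
    using charts[OF that] openin_subset unfolding chart_def by blast
  have kh_image: "k ` h ` V = V" if "V \<subseteq> topspace X" for V
    using that kh by (force simp: image_image)
  define B where "B = (\<lambda>(V, \<phi>). (h ` V, \<phi> \<circ> k)) ` A"
  have chartB: "chart Y (h ` V) (\<phi> \<circ> k)" if V: "(V, \<phi>) \<in> A" for V \<phi>
    unfolding chart_def
  proof (intro conjI)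
    have im: "(\<phi> \<circ> k) ` h ` V = \<phi> ` V"
      using kh_image[OF sub[OF V]] by (metis image_comp)
    show "openin Y (h ` V)"
      using charts[OF V] homeomorphic_imp_open_map[OF h] by (simp add: chart_def open_map_def)
    show "open ((\<phi> \<circ> k) ` h ` V)"
      using charts[OF V] unfolding im chart_def by blast
    have "h ` V \<subseteq> topspace Y"
      using sub[OF V] h_im by blast
    then have "k ` (topspace Y \<inter> h ` V) = topspace X \<inter> V"
      using kh_image[OF sub[OF V]] sub[OF V] by (simp add: inf.absorb2)
    then have "homeomorphic_map (subtopology Y (h ` V)) (subtopology X V) k"
      by (rule homeomorphic_map_subtopologies[OF k])
    moreover have "homeomorphic_map (subtopology X V) (top_of_set (\<phi> ` V)) \<phi>"
      using charts[OF V] by (simp add: chart_def)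
    ultimately show "homeomorphic_map (subtopology Y (h ` V)) (top_of_set ((\<phi> \<circ> k) ` h ` V)) (\<phi> \<circ> k)"
      unfolding im by (rule homeomorphic_map_compose)
  qed
  have smooth: "smooth_on ((\<psi> \<circ> k) \<circ> inv_into (h ` V) (\<phi> \<circ> k)) ((\<phi> \<circ> k) ` (h ` V \<inter> h ` W))"
    if V: "(V, \<phi>) \<in> A" and W: "(W, \<psi>) \<in> A" for V \<phi> W \<psi>
  proof -
    have "inj_on h (topspace X)"
      using h by (rule homeomorphic_imp_injective_map)
    then have "h ` V \<inter> h ` W = h ` (V \<inter> W)"
      using sub[OF V] sub[OF W] inj_on_image_Int by metis
    then have D: "(\<phi> \<circ> k) ` (h ` V \<inter> h ` W) = \<phi> ` (V \<inter> W)"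
      using kh_image[of "V \<inter> W"] sub[OF V] by (metis image_comp le_infI1)
    have "openin X W" using charts[OF W] by (simp add: chart_def)
    then have open_D: "open (\<phi> ` (V \<inter> W))"
      by (rule chart_open_image[OF charts[OF V]])
    show ?thesis
      unfolding D
    proof (rule smooth_on_cong[OF open_D])
      show "smooth_on (\<psi> \<circ> inv_into V \<phi>) (\<phi> ` (V \<inter> W))"
        by (rule bspec[OF bspec[OF transitions V, unfolded prod.case] W, unfolded prod.case])
      fix v assume "v \<in> \<phi> ` (V \<inter> W)"
      then obtain x where x: "x \<in> V" "v = \<phi> x" by blast
      have "k (h x) = x" using x(1) sub[OF V] kh by blast
      moreover have "inv_into V \<phi> v = x"
        unfolding x(2) by (rule inv_into_f_f[OF chart_inj[OF charts[OF V]] x(1)])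
      moreover have "inv_into (h ` V) (\<phi> \<circ> k) v = h x"
        using inv_into_f_f[OF chart_inj[OF chartB[OF V]], of "h x"] x \<open>k (h x) = x\<close> by simp
      ultimately show "(\<psi> \<circ> inv_into V \<phi>) v = ((\<psi> \<circ> k) \<circ> inv_into (h ` V) (\<phi> \<circ> k)) v"
        by simp
    qed
  qed
  have "(\<Union>(V, \<phi>)\<in>B. V) = h ` (\<Union>(V, \<phi>)\<in>A. V)"
    by (force simp: B_def)
  also have "(\<Union>(V, \<phi>)\<in>A. V) = topspace X"
    using A unfolding smooth_manifold_def smooth_atlas_def by blast
  finally have "(\<Union>(V, \<phi>)\<in>B. V) = topspace Y"
    using h_im by simp
  moreover have "\<forall>(V, \<phi>)\<in>B. chart Y V \<phi>"
    using chartB by (auto simp: B_def)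
  moreover have "\<forall>(V, \<phi>)\<in>B. \<forall>(W, \<psi>)\<in>B. smooth_on (\<psi> \<circ> inv_into V \<phi>) (\<phi> ` (V \<inter> W))"
  proof clarify
    fix V' \<phi>' W' \<psi>' assume "(V', \<phi>') \<in> B" "(W', \<psi>') \<in> B"
    then obtain V \<phi> W \<psi> where "(V, \<phi>) \<in> A" "V' = h ` V" "\<phi>' = \<phi> \<circ> k"
      "(W, \<psi>) \<in> A" "W' = h ` W" "\<psi>' = \<psi> \<circ> k"
      by (auto simp: B_def)
    then show "smooth_on (\<psi>' \<circ> inv_into V' \<phi>') (\<phi>' ` (V' \<inter> W'))"
      by (simp only: smooth)
  qed
  ultimately have "smooth_atlas Y B"
    by (simp add: smooth_atlas_def)
  moreover have "Hausdorff_space Y" "second_countable Y"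
    using A homeomorphic_Hausdorff_space[OF space] homeomorphic_space_second_countability[OF space]
    unfolding smooth_manifold_def by blast+
  ultimately show ?thesis
    unfolding smooth_manifold_def by blast
qed

section \<open>Smooth structures from slices\<close>

context fan_coordinates
begin

text \<open>A slice is a saturated open set \<open>W\<close> with an invariant smooth map \<open>\<Phi>\<close> that separates the orbits in \<open>W\<close>
  and has a global smooth section \<open>\<sigma>\<close>. It identifies the orbits in \<open>W\<close> with the Euclidean space in
  which \<open>\<Phi>\<close> takes its values, so every chart below is onto.\<close>

definition slice ::
    "(complex ^ 'm) set \<Rightarrow> (complex ^ 'm \<Rightarrow> 'e::euclidean_space) \<Rightarrow> ('e \<Rightarrow> complex ^ 'm) \<Rightarrow> bool" where
  "slice W \<Phi> \<sigma> \<longleftrightarrow>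
     open W \<and> W \<subseteq> U_space K \<and> smooth_on \<Phi> W \<and> smooth_on \<sigma> UNIV \<and>
     (\<forall>v. \<sigma> v \<in> W \<and> \<Phi> (\<sigma> v) = v) \<and>
     (\<forall>z\<in>W. \<exists>u. Lambda_R a u = 0 \<and> \<sigma> (\<Phi> z) = rescale u z) \<and>
     (\<forall>z\<in>W. \<forall>u. Lambda_R a u = 0 \<longrightarrow> rescale u z \<in> W \<and> \<Phi> (rescale u z) = \<Phi> z)"

text \<open>The map induced by \<open>\<Phi>\<close> on orbits, evaluated at an arbitrary representative.\<close>

definition slice_chart :: "(complex ^ 'm \<Rightarrow> 'e) \<Rightarrow> (complex ^ 'm) set \<Rightarrow> 'e" where
  "slice_chart \<Phi> X = \<Phi> (SOME z. z \<in> X)"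

context
  fixes W and \<Phi> :: "complex ^ 'm \<Rightarrow> 'e::euclidean_space" and \<sigma>
  assumes slice: "slice W \<Phi> \<sigma>"
begin

lemma slice_open: "open W" and slice_subset: "W \<subseteq> U_space K"
  and slice_smooth: "smooth_on \<Phi> W" and slice_section_smooth: "smooth_on \<sigma> UNIV"
  and slice_section_in: "\<sigma> v \<in> W" and slice_section: "\<Phi> (\<sigma> v) = v"
  using slice by (simp_all add: slice_def)

lemma slice_section_orbit:
  assumes "z \<in> W"
  obtains u where "Lambda_R a u = 0" "\<sigma> (\<Phi> z) = rescale u z"
  using slice assms unfolding slice_def by blast

lemma slice_invariant:
  "z \<in> W \<Longrightarrow> Lambda_R a u = 0 \<Longrightarrow> rescale u z \<in> W"
  "z \<in> W \<Longrightarrow> Lambda_R a u = 0 \<Longrightarrow> \<Phi> (rescale u z) = \<Phi> z"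
  using slice unfolding slice_def by blast+

lemma slice_chart_orbit:
  assumes "z \<in> W"
  shows "slice_chart \<Phi> (q z) = \<Phi> z"
proof -
  have z: "z \<in> U_space K" using assms slice_subset by blast
  have "z \<in> q z"
    unfolding orbit_eq[OF z] by (auto intro!: exI[of _ 0] simp: Lambda_R_linear)
  then have "(SOME w. w \<in> q z) \<in> q z" by (rule someI)
  then obtain u where "Lambda_R a u = 0" "(SOME w. w \<in> q z) = rescale u z"
    unfolding orbit_eq[OF z] by blast
  then show ?thesis
    using slice_invariant(2)[OF assms] by (simp add: slice_chart_def)
qed

lemma slice_saturated:
  assumes "z \<in> U_space K" "q z \<in> q ` W"
  shows "z \<in> W"
proof -
  obtain w where w: "w \<in> W" "q w = q z" using assms(2) by (metis imageE)
  then obtain u where "Lambda_R a u = 0" "z = rescale u w"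
    using orbit_eq_iff[of w z] slice_subset assms(1) by blast
  then show ?thesis using slice_invariant(1)[OF w(1)] by blast
qed

lemma orbit_slice_section:
  assumes "z \<in> W"
  shows "q (\<sigma> (\<Phi> z)) = q z"
proof -
  obtain u where "Lambda_R a u = 0" "\<sigma> (\<Phi> z) = rescale u z"
    using slice_section_orbit[OF assms] .
  moreover have "z \<in> U_space K" "\<sigma> (\<Phi> z) \<in> U_space K"
    using assms slice_section_in slice_subset by blast+
  ultimately have "q z = q (\<sigma> (\<Phi> z))"
    using orbit_eq_iff[of z "\<sigma> (\<Phi> z)"] by blast
  then show ?thesis ..
qed

lemma slice_chart_image: "slice_chart \<Phi> ` q ` W = UNIV"
proof -
  have "v \<in> slice_chart \<Phi> ` q ` W" for v
    using slice_section_in slice_chart_orbit slice_section by (metis image_eqI)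
  then show ?thesis by blast
qed

lemma slice_chart_is_chart: "chart orbits_top (q ` W) (slice_chart \<Phi>)"
proof -
  have V: "openin orbits_top (q ` W)"
    by (rule openin_orbit_image[OF slice_open slice_subset])
  have top: "topspace (subtopology orbits_top (q ` W)) = q ` W"
    using slice_subset by (auto simp: topspace_orbits)
  have "homeomorphic_maps (subtopology orbits_top (q ` W)) euclidean (slice_chart \<Phi>) (q \<circ> \<sigma>)"
    unfolding homeomorphic_maps_def
  proof (intro conjI)
    show "continuous_map (subtopology orbits_top (q ` W)) euclidean (slice_chart \<Phi>)"
      unfolding continuous_map_def top
    proof (intro conjI allI impI)
      fix T :: "'e set" assume "openin euclidean T"
      then have "open (W \<inter> \<Phi> -` T)"
        using continuous_open_preimage[OF smooth_on_continuous[OF slice_smooth] slice_open] by simp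
      then have "openin orbits_top (q ` (W \<inter> \<Phi> -` T))"
        using slice_subset by (intro openin_orbit_image) auto
      moreover have "{x \<in> q ` W. slice_chart \<Phi> x \<in> T} = q ` (W \<inter> \<Phi> -` T)"
        by (auto simp: slice_chart_orbit)
      ultimately show "openin (subtopology orbits_top (q ` W)) {x \<in> q ` W. slice_chart \<Phi> x \<in> T}"
        using V by (auto simp: openin_open_subtopology)
    qed auto
    have "continuous_map euclidean (top_of_set (U_space K)) \<sigma>"
      using smooth_on_continuous[OF slice_section_smooth] slice_section_in slice_subset
      by (auto simp: continuous_map_in_subtopology)
    then have "continuous_map euclidean orbits_top (q \<circ> \<sigma>)"
      by (rule continuous_map_compose[OF _ continuous_orbit])
    then show "continuous_map euclidean (subtopology orbits_top (q ` W)) (q \<circ> \<sigma>)"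
      by (rule continuous_map_into_subtopology) (auto simp: slice_section_in)
    show "\<forall>x\<in>topspace (subtopology orbits_top (q ` W)). (q \<circ> \<sigma>) (slice_chart \<Phi> x) = x"
      unfolding top by (auto simp: slice_chart_orbit orbit_slice_section)
    show "\<forall>v\<in>topspace euclidean. slice_chart \<Phi> ((q \<circ> \<sigma>) v) = v"
      by (simp add: slice_chart_orbit slice_section_in slice_section)
  qed
  then have "homeomorphic_map (subtopology orbits_top (q ` W)) euclidean (slice_chart \<Phi>)"
    by (auto simp: homeomorphic_maps_map)
  then show ?thesis
    using V by (simp add: chart_def slice_chart_image)
qed

lemma slice_chart_smooth: "smooth_on (slice_chart \<Phi> \<circ> q) W"
  by (rule smooth_on_cong[OF slice_open _ slice_smooth]) (simp add: slice_chart_orbit)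

text \<open>Through every point of \<open>W\<close> passes a rescaled copy of the section. The chart composed with that
  copy is the identity of the parameter space, so its derivative has a right inverse.\<close>

lemma slice_chart_submersive:
  assumes z: "z \<in> W"
  shows "surj (frechet_derivative (slice_chart \<Phi> \<circ> q) (at z))"
proof -
  obtain u where u: "Lambda_R a u = 0" "\<sigma> (\<Phi> z) = rescale u z"
    using slice_section_orbit[OF z] .
  let ?f = "slice_chart \<Phi> \<circ> q" and ?g = "\<lambda>v. rescale (- u) (\<sigma> v)"
  have nu: "Lambda_R a (- u) = 0" by (simp add: u Lambda_R_linear)
  have gz: "?g (\<Phi> z) = z"
    by (simp add: u rescale_uminus_eq_iff)
  have fg: "?f (?g v) = v" for v
    using slice_invariant[OF slice_section_in nu] by (simp add: slice_chart_orbit slice_section)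
  have f: "(?f has_derivative frechet_derivative ?f (at z)) (at z)"
    using smooth_on_differentiable[OF slice_chart_smooth z] by (simp add: frechet_derivative_works)
  have "(?g has_derivative (\<lambda>v. rescale (- u) (frechet_derivative \<sigma> (at (\<Phi> z)) v))) (at (\<Phi> z))"
    using smooth_on_differentiable[OF slice_section_smooth UNIV_I]
    by (intro bounded_linear.has_derivative[OF bounded_linear_rescale])
       (simp add: frechet_derivative_works)
  then have "((\<lambda>v. ?f (?g v)) has_derivative
      (\<lambda>v. frechet_derivative ?f (at z) (rescale (- u) (frechet_derivative \<sigma> (at (\<Phi> z)) v)))) (at (\<Phi> z))"
    by (rule has_derivative_compose) (use f in \<open>simp add: gz o_def\<close>)
  then have "((\<lambda>v. v) has_derivative
      (\<lambda>v. frechet_derivative ?f (at z) (rescale (- u) (frechet_derivative \<sigma> (at (\<Phi> z)) v)))) (at (\<Phi> z))"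
    unfolding fg .
  then have "(\<lambda>v. frechet_derivative ?f (at z) (rescale (- u) (frechet_derivative \<sigma> (at (\<Phi> z)) v))) = (\<lambda>v. v)"
    by (rule has_derivative_unique[OF _ has_derivative_ident])
  then show ?thesis
    by (intro surjI) (rule fun_cong)
qed

end

text \<open>On the overlap the transition map is \<open>\<Phi>' \<circ> \<sigma>\<close>: lift a parameter to \<open>W\<close> by the section and apply the
  other invariant map.\<close>

lemma slice_transition_smooth:
  fixes \<Phi> :: "complex ^ 'm \<Rightarrow> 'e::euclidean_space" and \<Phi>' :: "complex ^ 'm \<Rightarrow> 'e"
  assumes s: "slice W \<Phi> \<sigma>" and s': "slice W' \<Phi>' \<sigma>'"
  shows "smooth_on (slice_chart \<Phi>' \<circ> inv_into (q ` W) (slice_chart \<Phi>))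
           (slice_chart \<Phi> ` (q ` W \<inter> q ` W'))" (is "smooth_on _ ?D")
proof -
  have chart: "chart orbits_top (q ` W) (slice_chart \<Phi>)"
    by (rule slice_chart_is_chart[OF s])
  have "openin orbits_top (q ` W')"
    using openin_orbit_image slice_open[OF s'] slice_subset[OF s'] by blast
  then have open_D: "open ?D"
    by (rule chart_open_image[OF chart])
  have key: "\<sigma> v \<in> W'" "slice_chart \<Phi>' (inv_into (q ` W) (slice_chart \<Phi>) v) = \<Phi>' (\<sigma> v)"
    if v_in: "v \<in> ?D" for v
  proof -
    obtain w where w: "w \<in> W" "q w \<in> q ` W'" "v = slice_chart \<Phi> (q w)"
      using v_in by blast
    then have v: "v = \<Phi> w" by (simp add: slice_chart_orbit[OF s])
    have orb: "q (\<sigma> v) = q w"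
      unfolding v by (rule orbit_slice_section[OF s w(1)])
    have "\<sigma> v \<in> U_space K"
      using slice_section_in[OF s] slice_subset[OF s] by blast
    then show in_W': "\<sigma> v \<in> W'"
      by (rule slice_saturated[OF s']) (simp add: orb w(2))
    have "inv_into (q ` W) (slice_chart \<Phi>) v = q (\<sigma> v)"
      unfolding w(3) orb[unfolded w(3)] using w(1) by (intro inv_into_f_f[OF chart_inj[OF chart]]) auto
    then show "slice_chart \<Phi>' (inv_into (q ` W) (slice_chart \<Phi>) v) = \<Phi>' (\<sigma> v)"
      by (simp add: slice_chart_orbit[OF s' in_W'])
  qed
  show ?thesis
  proof (rule smooth_on_cong[OF open_D])
    show "smooth_on (\<lambda>v. \<Phi>' (\<sigma> v)) ?D"
      by (rule smooth_on_compose[OF open_D _ slice_smooth[OF s']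
            smooth_on_subset[OF slice_section_smooth[OF s]]]) (use key(1) in auto)
    show "\<Phi>' (\<sigma> v) = (slice_chart \<Phi>' \<circ> inv_into (q ` W) (slice_chart \<Phi>)) v" if "v \<in> ?D" for v
      using key(2)[OF that] by simp
  qed
qed

definition slice_atlas :: "((complex ^ 'm) set set \<times> ((complex ^ 'm) set \<Rightarrow> 'e::euclidean_space)) set" where
  "slice_atlas = {(q ` W, slice_chart \<Phi>) | W \<Phi>. \<exists>\<sigma>. slice W \<Phi> \<sigma>}"

context
  assumes cover: "\<And>z. z \<in> U_space K \<Longrightarrow>
    \<exists>W (\<Phi> :: complex ^ 'm \<Rightarrow> 'e::euclidean_space) \<sigma>. slice W \<Phi> \<sigma> \<and> z \<in> W"
begin

lemma smooth_manifold_orbits: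
  "smooth_manifold orbits_top (slice_atlas :: ((complex ^ 'm) set set \<times> ((complex ^ 'm) set \<Rightarrow> 'e)) set)"
  unfolding smooth_manifold_def smooth_atlas_def
proof (intro conjI Hausdorff_orbits second_countable_orbits)
  show "\<forall>(V, \<phi> :: _ \<Rightarrow> 'e)\<in>slice_atlas. chart orbits_top V \<phi>"
    by (auto simp: slice_atlas_def slice_chart_is_chart)
  show "\<forall>(V, \<phi> :: _ \<Rightarrow> 'e)\<in>slice_atlas. \<forall>(W, \<psi> :: _ \<Rightarrow> 'e)\<in>slice_atlas.
      smooth_on (\<psi> \<circ> inv_into V \<phi>) (\<phi> ` (V \<inter> W))"
    by (auto simp: slice_atlas_def slice_transition_smooth)
  show "(\<Union>(V, \<phi> :: _ \<Rightarrow> 'e)\<in>slice_atlas. V) = topspace orbits_top"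
  proof
    show "(\<Union>(V, \<phi> :: _ \<Rightarrow> 'e)\<in>slice_atlas. V) \<subseteq> topspace orbits_top"
      using slice_subset by (fastforce simp: slice_atlas_def topspace_orbits)
    show "topspace orbits_top \<subseteq> (\<Union>(V, \<phi> :: _ \<Rightarrow> 'e)\<in>slice_atlas. V)"
    proof
      fix x assume "x \<in> topspace orbits_top"
      then obtain z where z: "z \<in> U_space K" "x = q z" by (auto simp: topspace_orbits)
      obtain W and \<Phi> :: "complex ^ 'm \<Rightarrow> 'e" and \<sigma> where "slice W \<Phi> \<sigma>" "z \<in> W"
        using cover[OF z(1)] by blast
      then have "(q ` W, slice_chart \<Phi>) \<in> slice_atlas" "x \<in> q ` W"
        using z(2) by (auto simp: slice_atlas_def)
      then show "x \<in> (\<Union>(V, \<phi> :: _ \<Rightarrow> 'e)\<in>slice_atlas. V)" by blast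
    qed
  qed
qed

lemma smooth_submersion_orbit:
  "smooth_submersion (U_space K) orbits_top
     (slice_atlas :: ((complex ^ 'm) set set \<times> ((complex ^ 'm) set \<Rightarrow> 'e)) set) q"
  unfolding smooth_submersion_def
proof (intro conjI open_U_space continuous_orbit)
  show "q ` U_space K = topspace orbits_top" by (simp add: topspace_orbits)
  have "smooth_on (slice_chart \<Phi> \<circ> q) (U_space K \<inter> q -` q ` W) \<and>
      (\<forall>x\<in>U_space K \<inter> q -` q ` W. surj (frechet_derivative (slice_chart \<Phi> \<circ> q) (at x)))"
    if s: "slice W \<Phi> \<sigma>" for W \<sigma> and \<Phi> :: "complex ^ 'm \<Rightarrow> 'e"
  proof -
    have "U_space K \<inter> q -` q ` W = W"
      using slice_saturated[OF s] slice_subset[OF s] by blast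
    then show ?thesis
      using slice_chart_smooth[OF s] slice_chart_submersive[OF s] by simp
  qed
  then show "\<forall>(V, \<phi> :: _ \<Rightarrow> 'e)\<in>slice_atlas. smooth_on (\<phi> \<circ> q) (U_space K \<inter> q -` V) \<and>
      (\<forall>x\<in>U_space K \<inter> q -` V. surj (frechet_derivative (\<phi> \<circ> q) (at x)))"
    unfolding slice_atlas_def by blast
qed

end
end

section \<open>Cones of full dimension\<close>

context fan_coordinates
begin

text \<open>A linear relation among the \<open>a\<^sub>j\<close> with \<open>j \<in> J\<close> is a kernel vector supported on \<open>J\<close>, hence
  trivial.\<close>

lemma inj_on_independent_generators:
  assumes J: "J \<in> K"
  shows "inj_on a J" and "independent (a ` J)"
proof -
  show inj: "inj_on a J"
  proof (rule inj_onI, rule ccontr)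
    fix i j assume ij: "i \<in> J" "j \<in> J" "a i = a j" "i \<noteq> j"
    have "Lambda_R a (axis i 1) = a i" for i
    proof -
      have "Lambda_R a (axis i 1) = (\<Sum>k\<in>UNIV. if k = i then a k else 0)"
        unfolding Lambda_R_def by (rule sum.cong) (auto simp: axis_def)
      then show ?thesis by simp
    qed
    then have "Lambda_R a (axis i 1 - axis j 1) = 0"
      using ij by (simp add: Lambda_R_linear)
    then have "axis i 1 - axis j 1 = (0 :: real ^ 'm)"
      by (rule kernel_trivial_supported[OF _ J]) (use ij in \<open>auto simp: axis_def\<close>)
    then have "(axis i 1 - axis j 1) $ i = (0 :: real)" by simp
    then show False using ij(4) by (simp add: axis_def)
  qed
  show "independent (a ` J)"
  proof (rule independent_if_scalars_zero)
    fix f x assume sum: "(\<Sum>x\<in>a ` J. f x *\<^sub>R x) = 0" and x: "x \<in> a ` J"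
    define u :: "real ^ 'm" where "u = (\<chi> i. if i \<in> J then f (a i) else 0)"
    have "Lambda_R a u = (\<Sum>i\<in>J. f (a i) *\<^sub>R a i)"
      unfolding Lambda_R_def by (rule sum.mono_neutral_cong_right) (auto simp: u_def)
    also have "\<dots> = 0"
      using sum by (simp add: sum.reindex[OF inj])
    finally have "u = 0"
      by (rule kernel_trivial_supported[OF _ J]) (simp add: u_def)
    obtain i where i: "i \<in> J" "x = a i" using x by blast
    then have "f x = u $ i" by (simp add: u_def)
    then show "f x = 0"
      by (simp add: \<open>u = 0\<close>)
  qed simp
qed

lemma card_le_dimension: "J \<in> K \<Longrightarrow> card J \<le> DIM('v)"
  using inj_on_independent_generators[of J] independent_bound[of "a ` J"] by (simp add: card_image)

text \<open>The cones of lower dimension form a negligible set, so the closed union of the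
  full-dimensional ones is everything.\<close>

lemma full_dimensional_cones_cover:
  "\<exists>J\<in>K. card J = DIM('v) \<and> x \<in> convex_cone hull (a ` J)"
proof -
  define D where "D = (\<Union>J\<in>{J \<in> K. card J = DIM('v)}. convex_cone hull (a ` J))"
  define L where "L = (\<Union>J\<in>{J \<in> K. card J < DIM('v)}. span (a ` J))"
  have "closed D"
    unfolding D_def by (auto intro!: closed_UN closed_convex_cone_hull)
  have "negligible (span (a ` J))" if "card J < DIM('v)" for J
  proof (rule negligible_lowdim)
    have "dim (span (a ` J)) \<le> card (a ` J)"
      by (simp add: dim_le_card')
    also have "\<dots> \<le> card J" by (rule card_image_le) simp
    finally show "dim (span (a ` J)) < DIM('v)" using that by simp
  qed
  then have "negligible L"
    unfolding L_def by (intro negligible_Union) auto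
  have "- D \<subseteq> L"
  proof
    fix x assume x: "x \<in> - D"
    obtain y where y: "\<And>i. 0 \<le> y $ i" "{i. y $ i \<noteq> 0} \<in> K" "Lambda_R a y = x"
      using representation by blast
    let ?J = "{i. y $ i \<noteq> 0}"
    have "x = (\<Sum>i\<in>?J. y $ i *\<^sub>R a i)"
      unfolding y(3)[symmetric] Lambda_R_def by (rule sum.mono_neutral_right) auto
    also have "\<dots> \<in> convex_cone hull (a ` ?J)"
      by (subst convex_cone_hull_image) (use y(1) in \<open>auto intro!: exI[of _ "\<lambda>i. y $ i"]\<close>)
    finally have mem: "x \<in> convex_cone hull (a ` ?J)" .
    then have "card ?J \<noteq> DIM('v)"
      using x y(2) by (auto simp: D_def)
    then have "card ?J < DIM('v)"
      using card_le_dimension[OF y(2)] by simp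
    moreover have "convex_cone hull (a ` ?J) \<subseteq> span (a ` ?J)"
      by (intro hull_minimal convex_cone_span span_superset)
    ultimately show "x \<in> L"
      unfolding L_def using y(2) mem by blast
  qed
  then have "negligible (- D)"
    using \<open>negligible L\<close> negligible_subset by blast
  then have "- D = {}"
    using \<open>closed D\<close> open_not_negligible open_Compl by blast
  then have "x \<in> D" by blast
  then show ?thesis by (auto simp: D_def)
qed

text \<open>The sum of the generators indexed by \<open>I\<close> lies in some full-dimensional cone; uniqueness of the
  representation forces all of \<open>I\<close> to occur among the generators of that cone.\<close>

lemma extend_to_full_dimension:
  assumes I: "I \<in> K"
  obtains J where "J \<in> K" "I \<subseteq> J" "card J = DIM('v)"
proof -
  define e :: "real ^ 'm" where "e = (\<chi> i. if i \<in> I then 1 else 0)"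
  obtain J where J: "J \<in> K" "card J = DIM('v)" "Lambda_R a e \<in> convex_cone hull (a ` J)"
    using full_dimensional_cones_cover by blast
  obtain c where c: "\<forall>i\<in>J. 0 \<le> c i" "Lambda_R a e = (\<Sum>i\<in>J. c i *\<^sub>R a i)"
    using J(3) convex_cone_hull_image[of J a] by auto
  define y :: "real ^ 'm" where "y = (\<chi> i. if i \<in> J then c i else 0)"
  have "Lambda_R a y = (\<Sum>i\<in>J. c i *\<^sub>R a i)"
    unfolding Lambda_R_def by (rule sum.mono_neutral_cong_right) (auto simp: y_def)
  then have "Lambda_R a (e - y) = 0"
    by (simp add: Lambda_R_linear c(2))
  then have "e - y = 0"
  proof (rule kernel_trivial)
    have y_nonneg: "0 \<le> y $ i" for i using c(1) by (simp add: y_def)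
    have "i \<in> I" if "0 < (e - y) $ i" for i
      using that y_nonneg[of i] by (cases "i \<in> I") (simp_all add: e_def)
    then show "{i. 0 < (e - y) $ i} \<in> K"
      using down_closed[OF I] by (simp add: subset_iff)
    have "i \<in> J" if "(e - y) $ i < 0" for i
      using that by (cases "i \<in> J") (simp_all add: e_def y_def split: if_splits)
    then show "{i. (e - y) $ i < 0} \<in> K"
      using down_closed[OF J(1)] by (simp add: subset_iff)
  qed
  then have "e $ i = y $ i" for i by simp
  then have "I \<subseteq> J"
    by (auto simp: e_def y_def split: if_splits) (metis zero_neq_one)
  then show ?thesis using that J by blast
qed

lemma full_dimensional_coefficients:
  assumes J: "J \<in> K" "card J = DIM('v)"
  obtains B where "\<And>j. a j = (\<Sum>i\<in>J. B j i *\<^sub>R a i)"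
proof -
  note ind = inj_on_independent_generators[OF J(1)]
  have "UNIV \<subseteq> span (a ` J)"
    by (rule card_ge_dim_independent) (use ind J(2) in \<open>simp_all add: card_image\<close>)
  then have "a j \<in> span (a ` J)" for j by blast
  then have "\<exists>f. a j = (\<Sum>x\<in>a ` J. f x *\<^sub>R x)" for j
    by (auto simp: span_finite)
  then have "\<exists>f. a j = (\<Sum>i\<in>J. f i *\<^sub>R a i)" for j
    unfolding sum.reindex[OF ind(1)] o_def by metis
  then show ?thesis using that by metis
qed

end

section \<open>Explicit slices\<close>

text \<open>Stereographic projection of the circle from the point \<open>-c\<close>, made homogeneous so that it applies to
  every nonzero \<open>z\<close> off the ray through \<open>-c\<close>. For \<open>c = 1\<close> the coordinate \<open>s\<close> is the tangent of half
  the argument, and the formula for the inverse is the rational parametrization of the circle.\<close>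

lemma stereographic_inverse:
  fixes z :: complex and c :: real
  assumes c: "c = 1 \<or> c = -1" and pos: "0 < norm z + c * Re z"
  defines "s \<equiv> c * Im z / (norm z + c * Re z)"
  shows "(c / (1 + s\<^sup>2)) *\<^sub>R Complex (1 - s\<^sup>2) (2 * s) = (1 / norm z) *\<^sub>R z"
proof -
  define r d where "r = norm z" and "d = norm z + c * Re z"
  have r2: "r\<^sup>2 = (Re z)\<^sup>2 + (Im z)\<^sup>2" by (simp add: r_def cmod_power2)
  have c2: "c * c = 1" using c by auto
  have d: "0 < d" "d = r + c * Re z" using pos by (simp_all add: d_def r_def)
  have z: "z \<noteq> 0" using pos by auto
  then have r: "0 < r" by (simp add: r_def)
  have s2: "s\<^sup>2 = (Im z)\<^sup>2 / d\<^sup>2"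
    using c by (auto simp: s_def d_def power_divide power_mult_distrib)
  have "1 + s\<^sup>2 = (d\<^sup>2 + (Im z)\<^sup>2) / d\<^sup>2"
    unfolding s2 using d(1) by (simp add: add_divide_distrib)
  also have "d\<^sup>2 + (Im z)\<^sup>2 = 2 * r * d"
    using c r2 d(2) by (auto simp: power2_eq_square algebra_simps)
  finally have plus: "1 + s\<^sup>2 = 2 * r / d"
    using d(1) by (simp add: power2_eq_square)
  have "1 - s\<^sup>2 = (d\<^sup>2 - (Im z)\<^sup>2) / d\<^sup>2"
    unfolding s2 using d(1) by (simp add: diff_divide_distrib)
  also have "d\<^sup>2 - (Im z)\<^sup>2 = 2 * c * Re z * d"
    using c r2 d(2) by (auto simp: power2_eq_square algebra_simps)
  finally have minus: "1 - s\<^sup>2 = 2 * c * Re z / d"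
    using d(1) by (simp add: power2_eq_square)
  have "c / (1 + s\<^sup>2) * (1 - s\<^sup>2) = Re z / r"
    unfolding plus minus using c d(1) r by (auto simp: field_simps)
  moreover have "c / (1 + s\<^sup>2) * (2 * s) = Im z / r"
    unfolding plus using c d(1) r by (auto simp: s_def d_def[symmetric] field_simps)
  ultimately show ?thesis
    by (simp add: complex_eq_iff r_def)
qed

lemma stereographic_section:
  fixes c s :: real
  assumes c: "c = 1 \<or> c = -1"
  defines "z \<equiv> (c / (1 + s\<^sup>2)) *\<^sub>R Complex (1 - s\<^sup>2) (2 * s)"
  shows "norm z = 1" "0 < norm z + c * Re z" "c * Im z / (norm z + c * Re z) = s"
proof -
  have pos: "0 < 1 + s\<^sup>2" by (simp add: add_pos_nonneg)
  have "norm (Complex (1 - s\<^sup>2) (2 * s)) = sqrt ((1 + s\<^sup>2)\<^sup>2)"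
    unfolding complex_norm by (rule arg_cong[of _ _ sqrt]) (simp add: power2_eq_square algebra_simps)
  also have "\<dots> = 1 + s\<^sup>2" using pos by simp
  finally show n: "norm z = 1"
    using c pos by (auto simp: z_def)
  have "c * Re z = (1 - s\<^sup>2) / (1 + s\<^sup>2)"
    using c by (auto simp: z_def)
  then have sum: "norm z + c * Re z = 2 / (1 + s\<^sup>2)"
    using pos by (simp add: n field_simps)
  then show "0 < norm z + c * Re z" using pos by simp
  have "c * Im z = 2 * s / (1 + s\<^sup>2)"
    using c by (auto simp: z_def)
  then show "c * Im z / (norm z + c * Re z) = s"
    using pos by (simp add: sum)
qed

text \<open>\<open>J\<close> indexes the rays of a full-dimensional cone, and \<open>B\<close> expresses every generator in the basis that
  they form. The bijection \<open>\<beta>\<close> makes room for the imaginary parts of the coordinates in \<open>J\<close>, and the sign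
  \<open>c j\<close> says that the point \<open>- c j\<close> is omitted from the \<open>j\<close>-th circle.\<close>

locale fan_chart = fan_coordinates a K
  for a :: "'m::finite \<Rightarrow> real ^ 'n" and K :: "'m set set" +
  fixes J :: "'m set" and B :: "'m \<Rightarrow> 'm \<Rightarrow> real" and \<beta> :: "'n \<Rightarrow> 'm" and c :: "'m \<Rightarrow> real"
  assumes J: "J \<in> K"
    and B: "\<And>j. a j = (\<Sum>i\<in>J. B j i *\<^sub>R a i)"
    and \<beta>: "bij_betw \<beta> UNIV J"
    and c: "\<And>i. c i = 1 \<or> c i = -1"
begin

text \<open>The kernel vector with prescribed coordinates outside \<open>J\<close>: the contribution of those coordinates
  to \<open>\<Lambda>\<close> is expanded in the basis and cancelled by the coordinates in \<open>J\<close>.\<close>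

definition kernel_extension :: "real ^ 'm \<Rightarrow> real ^ 'm" where
  "kernel_extension y = (\<chi> i. if i \<in> J then - (\<Sum>j\<in>-J. y $ j * B j i) else y $ i)"

lemma Lambda_kernel_extension: "Lambda_R a (kernel_extension y) = 0"
proof -
  have "Lambda_R a (kernel_extension y) =
      (\<Sum>i\<in>J. kernel_extension y $ i *\<^sub>R a i) + (\<Sum>j\<in>-J. kernel_extension y $ j *\<^sub>R a j)"
    unfolding Lambda_R_def by (subst sum.union_disjoint[symmetric]) auto
  also have "(\<Sum>j\<in>-J. kernel_extension y $ j *\<^sub>R a j) = (\<Sum>j\<in>-J. \<Sum>i\<in>J. (y $ j * B j i) *\<^sub>R a i)"
  proof (rule sum.cong)
    fix j assume "j \<in> - J"
    then have "kernel_extension y $ j *\<^sub>R a j = y $ j *\<^sub>R (\<Sum>i\<in>J. B j i *\<^sub>R a i)"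
      unfolding B[of j, symmetric] by (simp add: kernel_extension_def)
    then show "kernel_extension y $ j *\<^sub>R a j = (\<Sum>i\<in>J. (y $ j * B j i) *\<^sub>R a i)"
      by (simp add: scaleR_sum_right)
  qed simp
  also have "\<dots> = (\<Sum>i\<in>J. \<Sum>j\<in>-J. (y $ j * B j i) *\<^sub>R a i)"
    by (rule sum.swap)
  also have "(\<Sum>i\<in>J. kernel_extension y $ i *\<^sub>R a i) = - \<dots>"
    by (simp add: kernel_extension_def scaleR_sum_left sum_negf)
  finally show ?thesis by simp
qed

lemma kernel_extension_kernel:
  assumes "Lambda_R a u = 0"
  shows "kernel_extension u = u"
proof -
  have "kernel_extension u - u = 0"
    by (rule kernel_trivial_supported[OF _ J])
       (simp_all add: Lambda_R_linear Lambda_kernel_extension assms, simp add: kernel_extension_def)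
  then show ?thesis by simp
qed

lemma kernel_extension_cong:
  "(\<And>j. j \<notin> J \<Longrightarrow> x $ j = y $ j) \<Longrightarrow> kernel_extension x = kernel_extension y"
  by (simp add: kernel_extension_def vec_eq_iff)

lemma kernel_extension_diff: "kernel_extension (x - y) = kernel_extension x - kernel_extension y"
  by (simp add: kernel_extension_def vec_eq_iff left_diff_distrib sum_subtractf)

text \<open>The representative of an orbit whose coordinates outside \<open>J\<close> have absolute value one.\<close>

definition normalise :: "complex ^ 'm \<Rightarrow> complex ^ 'm" where
  "normalise z = rescale (kernel_extension (\<chi> j. - ln (norm (z $ j)))) z"

text \<open>The condition says that \<open>z\<^sub>j\<close> is nonzero and not on the ray through \<open>- c j\<close>.\<close>

definition chart_domain :: "(complex ^ 'm) set" where
  "chart_domain = {z. \<forall>j. j \<notin> J \<longrightarrow> 0 < norm (z $ j) + c j * Re (z $ j)}"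

text \<open>Since \<open>J\<close> has as many elements as \<open>'n\<close>, the additional slots \<open>Inr k\<close> are exactly enough for the
  imaginary parts of the coordinates in \<open>J\<close>; a circle needs only one slot, filled by its
  stereographic coordinate.\<close>

definition coords :: "complex ^ 'm \<Rightarrow> real ^ ('m + 'n)" where
  "coords z = (\<chi> s. case s of
      Inl i \<Rightarrow> if i \<in> J then Re (normalise z $ i) else c i * Im (z $ i) / (norm (z $ i) + c i * Re (z $ i))
    | Inr k \<Rightarrow> Im (normalise z $ \<beta> k))"

definition parametrise :: "real ^ ('m + 'n) \<Rightarrow> complex ^ 'm" where
  "parametrise v = (\<chi> i. if i \<in> J then Complex (v $ Inl i) (v $ Inr (inv_into UNIV \<beta> i))
     else (c i / (1 + (v $ Inl i)\<^sup>2)) *\<^sub>R Complex (1 - (v $ Inl i)\<^sup>2) (2 * v $ Inl i))"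

lemma domain_nonzero: "z \<in> chart_domain \<Longrightarrow> j \<notin> J \<Longrightarrow> z $ j \<noteq> 0"
  by (auto simp: chart_domain_def)

text \<open>Written with real powers, the normalization is visibly smooth.\<close>

lemma normalise_in:
  assumes "z \<in> chart_domain" "i \<in> J"
  shows "normalise z $ i = (\<Prod>j\<in>-J. norm (z $ j) powr B j i) *\<^sub>R z $ i"
proof -
  have "exp (\<Sum>j\<in>-J. B j i * ln (norm (z $ j))) = (\<Prod>j\<in>-J. norm (z $ j) powr B j i)"
    using domain_nonzero[OF assms(1)] by (simp add: exp_sum powr_def)
  then show ?thesis
    using assms(2) by (simp add: normalise_def kernel_extension_def sum_negf mult.commute)
qed

lemma normalise_notin:
  assumes "z \<in> chart_domain" "i \<notin> J"
  shows "normalise z $ i = (1 / norm (z $ i)) *\<^sub>R z $ i"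
  using assms domain_nonzero[OF assms]
  by (simp add: normalise_def kernel_extension_def exp_minus divide_inverse)

lemma rescale_in_domain:
  assumes "z \<in> chart_domain"
  shows "rescale u z \<in> chart_domain"
proof -
  have "norm (rescale u z $ j) + c j * Re (rescale u z $ j) = exp (u $ j) * (norm (z $ j) + c j * Re (z $ j))" for j
    by (simp add: algebra_simps)
  then show ?thesis
    using assms by (simp add: chart_domain_def del: rescale_nth)
qed

text \<open>Rescaling by \<open>u\<close> shifts the logarithms outside \<open>J\<close> by \<open>u\<close>, and \<open>u\<close> is the only kernel vector with
  these coordinates, so the normalizing factor absorbs it.\<close>

lemma normalise_invariant:
  assumes z: "z \<in> chart_domain" and u: "Lambda_R a u = 0"
  shows "normalise (rescale u z) = normalise z"
proof -
  let ?y = "\<chi> j. - ln (norm (z $ j))"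
  have "kernel_extension (\<chi> j. - ln (norm (rescale u z $ j))) = kernel_extension (?y - u)"
    by (rule kernel_extension_cong) (simp add: ln_mult domain_nonzero[OF z])
  also have "\<dots> = kernel_extension ?y - u"
    by (simp add: kernel_extension_diff kernel_extension_kernel[OF u])
  finally show ?thesis
    by (simp add: normalise_def del: rescale_nth)
qed

lemma coords_invariant:
  assumes z: "z \<in> chart_domain" and u: "Lambda_R a u = 0"
  shows "coords (rescale u z) = coords z"
proof -
  have ratio: "c i * Im (rescale u z $ i) / (norm (rescale u z $ i) + c i * Re (rescale u z $ i))
      = c i * Im (z $ i) / (norm (z $ i) + c i * Re (z $ i))" for i
  proof -
    have "norm (rescale u z $ i) + c i * Re (rescale u z $ i)
        = exp (u $ i) * (norm (z $ i) + c i * Re (z $ i))"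
      by (simp add: algebra_simps)
    moreover have "c i * Im (rescale u z $ i) = exp (u $ i) * (c i * Im (z $ i))" by simp
    ultimately show ?thesis
      by (simp only:) simp
  qed
  show ?thesis
    unfolding coords_def normalise_invariant[OF z u] ratio ..
qed

lemma parametrise_notin:
  assumes "i \<notin> J"
  shows "norm (parametrise v $ i) = 1"
    and "0 < norm (parametrise v $ i) + c i * Re (parametrise v $ i)"
    and "c i * Im (parametrise v $ i) / (norm (parametrise v $ i) + c i * Re (parametrise v $ i)) = v $ Inl i"
proof -
  have "parametrise v $ i = (c i / (1 + (v $ Inl i)\<^sup>2)) *\<^sub>R Complex (1 - (v $ Inl i)\<^sup>2) (2 * v $ Inl i)"
    using assms by (simp add: parametrise_def)
  then show "norm (parametrise v $ i) = 1"
    and "0 < norm (parametrise v $ i) + c i * Re (parametrise v $ i)"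
    and "c i * Im (parametrise v $ i) / (norm (parametrise v $ i) + c i * Re (parametrise v $ i)) = v $ Inl i"
    by (elim ssubst, intro stereographic_section c)+
qed

lemma parametrise_in_domain: "parametrise v \<in> chart_domain"
  by (simp add: chart_domain_def parametrise_notin(2))

lemma normalise_parametrise: "normalise (parametrise v) = parametrise v"
proof -
  have "kernel_extension (\<chi> j. - ln (norm (parametrise v $ j))) = kernel_extension 0"
    by (rule kernel_extension_cong) (simp add: parametrise_notin(1))
  also have "\<dots> = 0"
    by (rule kernel_extension_kernel) (rule Lambda_R_linear(1))
  finally show ?thesis
    by (simp add: normalise_def)
qed

lemma coords_parametrise: "coords (parametrise v) = v"
proof -
  have inverse: "\<beta> k \<in> J" "inv_into UNIV \<beta> (\<beta> k) = k" for k
    using \<beta> by (auto simp: bij_betw_def inv_into_f_f)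
  have "coords (parametrise v) $ s = v $ s" for s
  proof (cases s)
    case (Inl i)
    show ?thesis
    proof (cases "i \<in> J")
      case True
      then show ?thesis by (simp add: Inl coords_def normalise_parametrise) (simp add: parametrise_def)
    next
      case False
      then show ?thesis by (simp add: Inl coords_def parametrise_notin(3))
    qed
  next
    case (Inr k)
    show ?thesis
      by (simp add: Inr coords_def normalise_parametrise) (simp add: parametrise_def inverse)
  qed
  then show ?thesis by (simp add: vec_eq_iff)
qed

lemma parametrise_coords:
  assumes z: "z \<in> chart_domain"
  shows "parametrise (coords z) = normalise z"
proof -
  have "parametrise (coords z) $ i = normalise z $ i" for i
  proof (cases "i \<in> J")
    case True
    then have "\<beta> (inv_into UNIV \<beta> i) = i"
      using \<beta> by (intro f_inv_into_f) (simp add: bij_betw_def)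
    then show ?thesis
      using True by (simp add: parametrise_def coords_def)
  next
    case False
    then have "0 < norm (z $ i) + c i * Re (z $ i)"
      using z by (simp add: chart_domain_def)
    from stereographic_inverse[OF c this] show ?thesis
      using False by (simp add: normalise_notin[OF z] parametrise_def coords_def)
  qed
  then show ?thesis by (simp add: vec_eq_iff)
qed

lemma open_chart_domain: "open chart_domain"
proof -
  have "chart_domain = (\<Inter>j\<in>-J. {z. 0 < norm (z $ j) + c j * Re (z $ j)})"
    by (auto simp: chart_domain_def)
  also have "open \<dots>"
    by (intro open_INT) (auto intro!: open_Collect_less continuous_intros)
  finally show ?thesis .
qed

lemma chart_domain_subset: "chart_domain \<subseteq> U_space K"
proof
  fix z assume "z \<in> chart_domain"
  then have "{i. z $ i = 0} \<subseteq> J" using domain_nonzero by blast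
  then show "z \<in> U_space K"
    unfolding U_iff by (rule down_closed[OF J])
qed

lemma smooth_on_coords: "smooth_on coords chart_domain"
proof (rule smooth_on_vecI[OF open_chart_domain])
  note smooth_component = smooth_on_nth[OF open_chart_domain]
  have norm: "smooth_on (\<lambda>z. norm (z $ j)) chart_domain" if "j \<notin> J" for j
    by (rule smooth_on_norm_complex[OF open_chart_domain smooth_component])
       (rule domain_nonzero[OF _ that])
  have re: "smooth_on (\<lambda>z. Re (z $ j)) chart_domain" and im: "smooth_on (\<lambda>z. Im (z $ j)) chart_domain" for j
    by (rule smooth_on_linear_compose[OF open_chart_domain bounded_linear_Re smooth_component]
        smooth_on_linear_compose[OF open_chart_domain bounded_linear_Im smooth_component])+
  have normalised: "smooth_on (\<lambda>z. normalise z $ i) chart_domain" if i: "i \<in> J" for i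
  proof (rule smooth_on_cong[OF open_chart_domain])
    show "smooth_on (\<lambda>z. (\<Prod>j\<in>-J. norm (z $ j) powr B j i) *\<^sub>R z $ i) chart_domain"
      by (intro smooth_on_scaleR smooth_on_prod smooth_on_powr open_chart_domain smooth_component norm)
         (auto simp: domain_nonzero)
  qed (simp add: normalise_in[OF _ i])
  fix s :: "'m + 'n"
  show "smooth_on (\<lambda>z. coords z $ s) chart_domain"
  proof (cases s)
    case (Inr k)
    then show ?thesis
      using \<beta> smooth_on_linear_compose[OF open_chart_domain bounded_linear_Im normalised[of "\<beta> k"]]
      by (auto simp: coords_def bij_betw_def)
  next
    case (Inl i)
    show ?thesis
    proof (cases "i \<in> J")
      case True
      then show ?thesis
        using smooth_on_linear_compose[OF open_chart_domain bounded_linear_Re normalised[OF True]]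
        by (simp add: coords_def Inl)
    next
      case False
      have "smooth_on (\<lambda>z. c i * Im (z $ i) / (norm (z $ i) + c i * Re (z $ i))) chart_domain"
        by (intro smooth_on_divide smooth_on_add smooth_on_mult smooth_on_const open_chart_domain
            re im norm[OF False]) (use False in \<open>simp add: chart_domain_def\<close>)
      then show ?thesis using False by (simp add: coords_def Inl)
    qed
  qed
qed

lemma smooth_on_parametrise: "smooth_on parametrise UNIV"
proof (rule smooth_on_vecI[OF open_UNIV])
  note smooth_component = smooth_on_nth[OF open_UNIV]
  fix i :: 'm
  show "smooth_on (\<lambda>v. parametrise v $ i) UNIV"
  proof (cases "i \<in> J")
    case True
    then show ?thesis
      by (intro smooth_on_complexI open_UNIV) (simp_all add: parametrise_def smooth_component)
  next
    case False
    have sq: "smooth_on (\<lambda>v :: real ^ ('m + 'n). (v $ Inl i)\<^sup>2) UNIV"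
      unfolding power2_eq_square by (intro smooth_on_mult smooth_component open_UNIV)
    have pos: "0 < 1 + x\<^sup>2" for x :: real
      by (simp add: add_pos_nonneg)
    have "smooth_on (\<lambda>v :: real ^ ('m + 'n). c i / (1 + (v $ Inl i)\<^sup>2) * (1 - (v $ Inl i)\<^sup>2)) UNIV"
      by (intro smooth_on_mult smooth_on_diff smooth_on_divide smooth_on_add smooth_on_const sq open_UNIV pos)
    moreover have "smooth_on (\<lambda>v :: real ^ ('m + 'n). c i / (1 + (v $ Inl i)\<^sup>2) * (2 * v $ Inl i)) UNIV"
      by (intro smooth_on_mult smooth_on_divide smooth_on_add smooth_on_const sq open_UNIV pos smooth_component)
    ultimately show ?thesis
      using False by (intro smooth_on_complexI open_UNIV) (simp_all add: parametrise_def)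
  qed
qed

lemma slice_coords: "slice chart_domain coords parametrise"
proof -
  have "\<exists>u. Lambda_R a u = 0 \<and> parametrise (coords z) = rescale u z" if "z \<in> chart_domain" for z
    unfolding parametrise_coords[OF that] normalise_def using Lambda_kernel_extension by blast
  then show ?thesis
    unfolding slice_def
    using open_chart_domain chart_domain_subset smooth_on_coords smooth_on_parametrise
      parametrise_in_domain coords_parametrise rescale_in_domain coords_invariant
    by blast
qed

end

section \<open>The quotient and the moment-angle complex\<close>

theorem theorem2p2:
  fixes \<Sigma> :: "(real ^ 'n) set set"
    and a :: "'m::finite \<Rightarrow> real ^ 'n"
    and K :: "'m set set"
  assumes "complete_fan \<Sigma>" and "simplicial_fan \<Sigma>"
    and "ray_generators \<Sigma> a"
    and "K = underlying_complex \<Sigma> a"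
  shows
    "(free_action (R_group a) (U_space K) (R_action K) \<and>
      proper_action (top_of_set (carrier (R_group a))) (R_group a)
        (top_of_set (U_space K)) (R_action K) \<and>
      (\<exists>A :: ((complex ^ 'm) set set \<times> ((complex ^ 'm) set \<Rightarrow> real ^ ('m + 'n))) set.
         smooth_manifold (orbit_space (top_of_set (U_space K)) (R_group a) (R_action K)) A \<and>
         smooth_submersion (U_space K)
           (orbit_space (top_of_set (U_space K)) (R_group a) (R_action K)) A
           (orbit (R_group a) (R_action K)))) \<and>
     (\<exists>h. homeomorphic_map (orbit_space (top_of_set (U_space K)) (R_group a) (R_action K))
             (top_of_set (moment_angle_complex K)) h \<and>
           (\<forall>t\<in>torus. \<forall>z\<in>U_space K.
              h (orbit (R_group a) (R_action K) (t * z)) =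
              t * h (orbit (R_group a) (R_action K) z))) \<and>
     (\<exists>B :: ((complex ^ 'm) set \<times> (complex ^ 'm \<Rightarrow> real ^ ('m + 'n))) set.
         smooth_manifold (top_of_set (moment_angle_complex K)) B)"
proof -
  interpret simplicial_ray_fan \<Sigma> a
    using assms(2,3) by unfold_locales
  interpret fan_coordinates a K
    using underlying_complex_down_closed kernel_support_unique complete_representation[OF assms(1)]
    unfolding assms(4) by unfold_locales
  have cover: "\<exists>W (\<Phi> :: complex ^ 'm \<Rightarrow> real ^ ('m + 'n)) \<sigma>. slice W \<Phi> \<sigma> \<and> z \<in> W"
    if z: "z \<in> U_space K" for z
  proof -
    have "{i. z $ i = 0} \<in> K" using z by (simp add: U_iff)
    then obtain J where full: "J \<in> K" "{i. z $ i = 0} \<subseteq> J" "card J = DIM(real ^ 'n)"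
      by (rule extend_to_full_dimension)
    obtain B where B: "\<And>j. a j = (\<Sum>i\<in>J. B j i *\<^sub>R a i)"
      by (rule full_dimensional_coefficients[OF full(1,3)]) (rule that)
    have "\<exists>\<beta> :: 'n \<Rightarrow> 'm. bij_betw \<beta> UNIV J"
      by (rule finite_same_card_bij) (use full(3) in simp_all)
    then obtain \<beta> :: "'n \<Rightarrow> 'm" where \<beta>: "bij_betw \<beta> UNIV J" ..
    \<comment> \<open>Project each circle from the point opposite to the half plane that contains \<open>z\<^sub>j\<close>.\<close>
    define c :: "'m \<Rightarrow> real" where "c i = (if 0 \<le> Re (z $ i) then 1 else -1)" for i
    interpret fan_chart a K J B \<beta> c
      by (intro fan_chart.intro fan_chart_axioms.intro fan_coordinates_axioms full(1) B \<beta>)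
         (simp add: c_def)
    have "0 < norm (z $ j) + c j * Re (z $ j)" if "j \<notin> J" for j
    proof -
      have "0 < norm (z $ j)" using full(2) that by auto
      moreover have "0 \<le> c j * Re (z $ j)" by (simp add: c_def)
      ultimately show ?thesis by linarith
    qed
    then have "z \<in> chart_domain" by (simp add: chart_domain_def)
    then show ?thesis using slice_coords by blast
  qed
  obtain h where h: "homeomorphic_map orbits_top (top_of_set (moment_angle_complex K)) h"
    "\<And>t z. t \<in> torus \<Longrightarrow> z \<in> U_space K \<Longrightarrow> h (q (t * z)) = t * h (q z)"
    using orbit_space_homeomorphic_Z by blast
  note manifold = smooth_manifold_orbits[OF cover] and submersion = smooth_submersion_orbit[OF cover]
  show ?thesis
    using free_R proper_R manifold submersion h smooth_manifold_transport[OF h(1) manifold] by blast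
qed

end
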